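(* Let $p>3$ be a prime and let $m$ be a positive integer not divisible by $p$. (i) If $p>5$, then $$\sum_{k=1}^{p-1}\frac{(-1)^{km}}{k^2}\binom{p/m-1}{k}^m\equiv \frac1p\sum_{k=1}^{p-1}\frac1k\pmod{p^3}.$$ Also, for any $n=1,\ldots,(p-3)/2$, $$\sum_{k=1}^{p-1}\frac{(-1)^{km}}{k^{2n}}\binom{p/m-1}{k}^m\equiv -\frac{p}{2n+1}B_{p-1-2n}\pmod{p^2}.$$ (ii) For every $n=1,\ldots,(p-3)/2$, $$\sum_{k=1}^{p-1}\frac{(-1)^{km}}{k^{2n-1}}\binom{p/m-1}{k}^m\equiv\left(1+\frac{1-m}{2m}(2n+1)\right)\frac{p^2 n}{2n+1}B_{p-1-2n}\pmod{p^3}.$$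
   Context: For a rational number $x$ and a nonnegative integer $k$, $\binom{x}{k}=\frac{x(x-1)\cdots(x-k+1)}{k!}$. $B_0,B_1,B_2,\ldots$ are the Bernoulli numbers, defined by $\frac{x}{e^x-1}=\sum_{n\ge0}B_n\frac{x^n}{n!}$. For rationals $a,b$ whose denominators are prime to $p$, $a\equiv b \pmod{p^r}$ means that $(a-b)/p^r$ is a rational number whose denominator is prime to $p$. *)

theory Defs
  imports Complex_Main "HOL-Computational_Algebra.Computational_Algebra"
begin

text \<open>The quotient is the one of formal power series over a field: both arguments have
  subdegree 1, so it is the power series with
  \<open>x = (x / (e\<^sup>x - 1)) * (e\<^sup>x - 1)\<close>; see \<open>bernoulli_num_egf_mult\<close> below.\<close>

definition bernoulli_num :: "nat \<Rightarrow> rat" where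
  "bernoulli_num n = fact n * fps_nth (fps_X / (fps_exp 1 - 1)) n"

definition p_integral :: "nat \<Rightarrow> rat \<Rightarrow> bool" where
  "p_integral p x \<longleftrightarrow> coprime (snd (quotient_of x)) (int p)"

text \<open>The congruence is only meaningful between rationals whose denominators are prime to \<open>p\<close>,
  so this is made part of the relation.\<close>

definition rat_cong :: "rat \<Rightarrow> rat \<Rightarrow> nat \<Rightarrow> nat \<Rightarrow> bool" where
  "rat_cong a b p r \<longleftrightarrow>
     p_integral p a \<and> p_integral p b \<and> p_integral p ((a - b) / of_nat p ^ r)"

lemma bernoulli_num_egf:
  "Abs_fps (\<lambda>n. bernoulli_num n / fact n) = fps_X / (fps_exp 1 - 1)"
  by (simp add: fps_eq_iff bernoulli_num_def)

lemma bernoulli_num_egf_mult: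
  "Abs_fps (\<lambda>n. bernoulli_num n / fact n) * (fps_exp 1 - 1) = fps_X"
proof -
  have nth1: "fps_nth (fps_exp (1::rat) - 1) 1 = 1"
    by simp
  then have nz: "fps_exp (1::rat) - 1 \<noteq> 0"
    by (metis fps_zero_nth zero_neq_one)
  have "subdegree (fps_exp (1::rat) - 1) = 1"
    by (rule subdegreeI) (use nth1 in simp_all)
  then have "fps_exp (1::rat) - 1 dvd fps_X"
    by (simp add: fps_dvd_iff nz)
  then show ?thesis
    by (simp add: bernoulli_num_egf)
qed

end

theory Submission
  imports Defs "HOL-Number_Theory.Residues"
begin

text \<open>Up to sign, the \<open>m\<close>-th power of the binomial coefficient is the product of
  \<open>(1 - p / (m j))\<^sup>m\<close> over \<open>j \<le> k\<close>, which modulo \<open>p\<^sup>3\<close> differs from its value at \<open>m = 1\<close>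
  only by a multiple of \<open>p\<^sup>2 H\<^sub>k\<^sup>(\<^sup>2\<^sup>)\<close>. For \<open>m = 1\<close> the sum of index \<open>r\<close> is exactly minus the complete
  homogeneous symmetric polynomial \<open>h\<^sub>r\<close> at \<open>1, 1/2, \<dots>, 1/(p - 1)\<close>, and by Newton's identity
  \<open>r h\<^sub>r\<close> agrees with the harmonic sum of exponent \<open>r\<close> modulo \<open>p\<^sup>2\<close>, and modulo \<open>p\<^sup>3\<close> if \<open>r\<close> is
  odd. Comparing this, for even \<open>r\<close>, with the direct expansion of the sum modulo \<open>p\<^sup>2\<close> determines \<open>h\<^sub>r\<close>
  modulo \<open>p\<^sup>2\<close> from a double harmonic sum modulo \<open>p\<close>, so that no Kummer congruence is needed; the
  double sums modulo \<open>p\<close> follow from Faulhaber's formula and Fermat's little theorem. Odd exponents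
  are reduced to even ones by the reflection of \<open>k\<close> to \<open>p - k\<close>.\<close>

section \<open>Bernoulli numbers and harmonic sums\<close>

text \<open>Compare coefficients of X^(n+1) in the generating function identity and clear (n+1)!.
  Its top term has coefficient n+1, so it can be solved for B_n, which yields p-integrality by
  induction.\<close>

lemma bernoulli_num_recurrence:
  "(\<Sum>i\<le>n. of_nat (Suc n choose i) * bernoulli_num i) = (if n = 0 then 1 else 0)"
proof -
  have "fps_nth (Abs_fps (\<lambda>n. bernoulli_num n / fact n) * (fps_exp 1 - 1)) (Suc n)
      = (\<Sum>i\<le>n. bernoulli_num i / fact i / fact (Suc n - i))"
    by (simp add: fps_mult_nth atLeast0AtMost) (simp add: mult.commute)
  also have "\<dots> = (\<Sum>i\<le>n. of_nat (Suc n choose i) * bernoulli_num i) / fact (Suc n)"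
    unfolding sum_divide_distrib
    by (intro sum.cong refl) (auto simp: binomial_fact field_simps simp del: fact_Suc)
  finally have "(\<Sum>i\<le>n. of_nat (Suc n choose i) * bernoulli_num i) / fact (Suc n)
      = fps_nth (fps_X :: rat fps) (Suc n)"
    by (simp only: bernoulli_num_egf_mult)
  moreover have "fact (Suc n) \<noteq> (0 :: rat)"
    by (rule fact_nonzero)
  ultimately show ?thesis
    by (auto simp del: fact_Suc split: if_splits)
qed

text \<open>Coefficient of \<open>X\<^sup>s\<^sup>+\<^sup>1\<close> in
  \<open>X * (\<Sum>j<k. e\<^sup>j\<^sup>X) = (X / (e\<^sup>X - 1)) * (e\<^sup>k\<^sup>X - 1)\<close>.\<close>
lemma faulhaber:
  "(\<Sum>j<k. of_nat j ^ s :: rat)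
     = (\<Sum>i\<le>s. of_nat (Suc s choose i) * bernoulli_num i * of_nat k ^ (Suc s - i)) / of_nat (Suc s)"
proof -
  define B where "B = Abs_fps (\<lambda>n. bernoulli_num n / fact n)"
  \<comment> \<open>A geometric sum in e^X, written without division so that induction on
    \<open>k\<close> suffices.\<close>
  have geo: "(\<Sum>j<k. fps_exp (of_nat j)) * (fps_exp 1 - 1) = fps_exp (of_nat k :: rat) - 1"
  proof (induction k)
    case (Suc k)
    have "fps_exp (of_nat (Suc k) :: rat) = fps_exp (of_nat k) * fps_exp 1"
      by (simp flip: fps_exp_add_mult add: add.commute)
    with Suc show ?case
      by (simp add: algebra_simps)
  qed simp
  have "fps_X * (\<Sum>j<k. fps_exp (of_nat j)) = B * (fps_exp (of_nat k :: rat) - 1)"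
    unfolding geo[symmetric] B_def bernoulli_num_egf_mult[symmetric] by (simp only: mult_ac)
  then have "fps_nth (fps_X * (\<Sum>j<k. fps_exp (of_nat j))) (Suc s)
      = fps_nth (B * (fps_exp (of_nat k :: rat) - 1)) (Suc s)"
    by simp
  then have "(\<Sum>j<k. of_nat j ^ s / fact s)
      = (\<Sum>i\<le>s. bernoulli_num i / fact i * (of_nat k ^ (Suc s - i) / fact (Suc s - i)))"
    unfolding fps_X_mult_nth fps_mult_nth[of B]
    by (simp add: fps_sum_nth atLeast0AtMost B_def) (simp add: mult.commute)
  also have "\<dots> = (\<Sum>i\<le>s. of_nat (Suc s choose i) * bernoulli_num i * of_nat k ^ (Suc s - i))
      / fact (Suc s)"
    unfolding sum_divide_distrib
    by (intro sum.cong refl) (auto simp: binomial_fact field_simps simp del: fact_Suc)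
  finally show ?thesis
    by (simp add: field_simps del: of_nat_Suc flip: sum_divide_distrib)
qed

section \<open>Power sums and complete homogeneous polynomials of reciprocals\<close>

definition power_harmonic :: "nat \<Rightarrow> nat \<Rightarrow> rat" where
  "power_harmonic N r = (\<Sum>k = 1..N. 1 / of_nat k ^ r)"

lemma power_harmonic_0 [simp]: "power_harmonic 0 r = 0"
  by (simp add: power_harmonic_def)

lemma power_harmonic_Suc:
  "power_harmonic (Suc N) r = power_harmonic N r + 1 / of_nat (Suc N) ^ r"
  by (simp add: power_harmonic_def)

text \<open>\<open>complete_harmonic N r\<close> is the complete homogeneous symmetric polynomial of degree \<open>r\<close>
  at \<open>1, 1/2, \<dots>, 1/N\<close>.\<close>
fun complete_harmonic :: "nat \<Rightarrow> nat \<Rightarrow> rat" where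
  "complete_harmonic N 0 = 1"
| "complete_harmonic 0 (Suc r) = 0"
| "complete_harmonic (Suc N) (Suc r)
     = complete_harmonic N (Suc r) + complete_harmonic (Suc N) r / of_nat (Suc N)"

text \<open>Newton's identity as a logarithmic derivative: the generating function of the complete
  homogeneous polynomials is the product of 1/(1 - X/j), so its derivative is itself times the
  generating function of the power sums. Comparing coefficients of X^r gives the claim.\<close>

lemma complete_harmonic_newton:
  "of_nat (Suc r) * complete_harmonic N (Suc r)
     = (\<Sum>i\<le>r. power_harmonic N (Suc i) * complete_harmonic N (r - i))"
proof -
  define H where "H N = Abs_fps (complete_harmonic N)" for N
  define G where "G N = Abs_fps (\<lambda>i. power_harmonic N (Suc i))" for N
  \<comment> \<open>The factor by which passing from \<open>N\<close> to \<open>Suc N\<close>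
    divides the product; multiplying by it avoids power series inverses.\<close>
  define u :: "nat \<Rightarrow> rat fps" where "u N = 1 - fps_const (1 / of_nat (Suc N)) * fps_X" for N
  have u_nz: "u N \<noteq> 0" for N
  proof -
    have "fps_nth (u N) 0 = 1" by (simp add: u_def)
    then show ?thesis by auto
  qed
  have u_deriv: "fps_deriv (u N) = - fps_const (1 / of_nat (Suc N))" for N
    by (simp add: u_def)
  have H_Suc: "H (Suc N) * u N = H N" for N
  proof (rule fps_ext)
    fix n
    show "fps_nth (H (Suc N) * u N) n = fps_nth (H N) n"
      by (cases n) (simp_all add: H_def u_def algebra_simps)
  qed
  \<comment> \<open>The increment of \<open>G\<close> is the geometric series of
    1/(N+1)^(i+1).\<close>
  have G_Suc: "G (Suc N) * u N = G N * u N + fps_const (1 / of_nat (Suc N))" for N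
  proof -
    have "(G (Suc N) - G N) * u N = fps_const (1 / of_nat (Suc N))"
    proof (rule fps_ext)
      fix n
      show "fps_nth ((G (Suc N) - G N) * u N) n = fps_nth (fps_const (1 / of_nat (Suc N))) n"
        by (cases n) (simp_all add: G_def u_def algebra_simps power_harmonic_Suc)
    qed
    then show ?thesis by (simp add: algebra_simps)
  qed
  have "fps_deriv (H N) = G N * H N" for N
  proof (induction N)
    case 0
    have "H 0 = 1"
      by (rule fps_ext, rename_tac n, case_tac n) (simp_all add: H_def)
    moreover have "G 0 = 0"
      by (simp add: G_def fps_eq_iff)
    ultimately show ?case by simp
  next
    case (Suc N)
    have "fps_deriv (H (Suc N)) * u N = fps_deriv (H N) + H (Suc N) * fps_const (1 / of_nat (Suc N))"
      unfolding H_Suc[of N, symmetric] fps_deriv_mult u_deriv by (simp add: algebra_simps flip: fps_const_neg)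
    also have "\<dots> = G N * (H (Suc N) * u N) + H (Suc N) * fps_const (1 / of_nat (Suc N))"
      by (simp only: Suc H_Suc)
    also have "\<dots> = H (Suc N) * (G (Suc N) * u N)"
      unfolding G_Suc by (simp add: algebra_simps)
    finally show ?case
      using u_nz[of N] by (simp add: mult_ac)
  qed
  then have "fps_nth (fps_deriv (H N)) r = fps_nth (G N * H N) r"
    by simp
  then show ?thesis
    by (simp add: H_def G_def fps_mult_nth atLeast0AtMost)
qed

text \<open>Both sides obey the same recursion: Pascal's rule splits off a sum over
  \<open>N choose (k - 1)\<close>, and absorbing the factor 1/k there lowers \<open>r\<close> by
  one. At r = 0 the full alternating sum vanishes, so dropping k = 0 leaves -1; this fails for N =
  0, hence the hypothesis.\<close>

lemma alternating_binomial_sum_complete_harmonic: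
  assumes "N > 0 \<or> r > 0"
  shows "(\<Sum>k = 1..N. (- 1) ^ k * of_nat (N choose k) / of_nat k ^ r) = - complete_harmonic N r"
  using assms
proof (induction r arbitrary: N)
  case 0
  have "{..N} = insert 0 {1..N}" by auto
  then show ?case
    using choose_alternating_sum[of N, where ?'a = rat] 0
    by (simp add: eq_neg_iff_add_eq_0 add.commute)
next
  case (Suc r)
  note IH = Suc.IH
  show ?case
  proof (induction N)
    case (Suc N)
    have absorb: "of_nat (N choose (k - 1)) / of_nat k = (of_nat (Suc N choose k) / of_nat (Suc N) :: rat)"
      if k: "k \<in> {1..Suc N}" for k
    proof -
      obtain l where l: "k = Suc l" using k not0_implies_Suc[of k] by auto
      have "of_nat (Suc l * (Suc N choose Suc l)) = (of_nat (Suc N * (N choose l)) :: rat)"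
        using Suc_times_binomial_eq[of N l] by (simp only: mult.commute)
      then show ?thesis
        unfolding l of_nat_mult
        by (simp add: frac_eq_eq mult.commute del: of_nat_Suc binomial_Suc_Suc)
    qed
    have "(\<Sum>k = 1..Suc N. (- 1) ^ k * of_nat (Suc N choose k) / of_nat k ^ Suc r :: rat)
        = (\<Sum>k = 1..Suc N. (- 1) ^ k * of_nat (N choose k) / of_nat k ^ Suc r
            + (- 1) ^ k * (of_nat (Suc N choose k) / of_nat (Suc N)) / of_nat k ^ r)"
    proof (intro sum.cong refl)
      fix k assume k: "k \<in> {1..Suc N}"
      then obtain l where l: "k = Suc l" using not0_implies_Suc[of k] by auto
      show "(- 1) ^ k * of_nat (Suc N choose k) / of_nat k ^ Suc r
          = (- 1) ^ k * of_nat (N choose k) / of_nat k ^ Suc r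
            + (- 1) ^ k * (of_nat (Suc N choose k) / of_nat (Suc N)) / (of_nat k ^ r :: rat)"
        by (subst absorb[OF k, symmetric]) (simp add: l add_divide_distrib diff_divide_distrib distrib_left)
    qed
    also have "\<dots> = (\<Sum>k = 1..N. (- 1) ^ k * of_nat (N choose k) / of_nat k ^ Suc r)
        + (\<Sum>k = 1..Suc N. (- 1) ^ k * of_nat (Suc N choose k) / of_nat k ^ r) / of_nat (Suc N)"
      by (simp add: sum.distrib sum_divide_distrib diff_divide_distrib binomial_eq_0 mult_ac)
    also have "\<dots> = - complete_harmonic (Suc N) (Suc r)"
      using Suc.IH Suc.prems IH[of "Suc N"] by simp
    finally show ?case .
  qed simp
qed

text \<open>The factors of the binomial coefficient are (x - j)/j = -(1 - x/j), and the sign cancels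
  each minus.\<close>

lemma gbinomial_minus_one_prod:
  "(- 1) ^ k * ((x - 1) gchoose k) = (\<Prod>j = 1..k. 1 - x / of_nat j)" for x :: rat
proof (induction k)
  case (Suc k)
  have "((x - 1) gchoose Suc k) = ((x - 1) gchoose k) * (x - 1 - of_nat k) / of_nat (Suc k)"
    by (simp add: gbinomial_prod_rev field_simps)
  then have "(- 1) ^ Suc k * ((x - 1) gchoose Suc k)
      = ((- 1) ^ k * ((x - 1) gchoose k)) * (1 - x / of_nat (Suc k))"
    by (simp only:) (simp add: field_simps)
  then show ?case
    by (simp only: Suc) (simp add: mult.commute)
qed simp

text \<open>By symmetry the square counts each off-diagonal pair twice and the diagonal once; adding
  the diagonal again doubles the triangular sum.\<close>

lemma double_power_harmonic_diagonal:
  "2 * (\<Sum>k = 1..N. power_harmonic k r / of_nat k ^ r)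
     = power_harmonic N r ^ 2 + power_harmonic N (2 * r)"
proof (induction N)
  case (Suc N)
  define x :: rat where "x = 1 / of_nat (Suc N) ^ r"
  have "power_harmonic (Suc N) r = power_harmonic N r + x"
      "power_harmonic (Suc N) (2 * r) = power_harmonic N (2 * r) + x ^ 2"
    by (simp_all add: power_harmonic_Suc x_def power_divide power_mult mult.commute[of 2 r])
  moreover have "(\<Sum>k = 1..Suc N. power_harmonic k r / of_nat k ^ r)
      = (\<Sum>k = 1..N. power_harmonic k r / of_nat k ^ r) + power_harmonic (Suc N) r * x"
    by (simp add: x_def)
  ultimately show ?case
    using Suc by (simp add: power2_eq_square algebra_simps)
qed simp

text \<open>Faulhaber's formula handles the strict double sum over j < k, while the expansion in
  \<open>p\<close> produces j <= k; the diagonal is the difference.\<close>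

lemma double_power_harmonic_split:
  "(\<Sum>k = 1..N. power_harmonic k a / of_nat k ^ b)
     = (\<Sum>k = 1..N. power_harmonic (k - 1) a / of_nat k ^ b) + power_harmonic N (a + b)"
proof -
  have "power_harmonic k a / of_nat k ^ b
      = power_harmonic (k - 1) a / of_nat k ^ b + 1 / of_nat k ^ (a + b)" if k: "k \<in> {1..N}" for k
  proof -
    obtain l where "k = Suc l" using k not0_implies_Suc[of k] by auto
    then show ?thesis
      by (simp add: power_harmonic_Suc add_divide_distrib power_add)
  qed
  then have "(\<Sum>k = 1..N. power_harmonic k a / of_nat k ^ b)
      = (\<Sum>k = 1..N. power_harmonic (k - 1) a / of_nat k ^ b + 1 / of_nat k ^ (a + b))"
    by (rule sum.cong[OF refl])
  then show ?thesis
    by (simp only: sum.distrib power_harmonic_def[of N])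
qed

section \<open>Rationals with denominator prime to p\<close>

text \<open>With arbitrary representations allowed, closure under sums and products needs no
  reduction to lowest terms.\<close>

lemma p_integral_iff:
  assumes "prime p"
  shows "p_integral p x \<longleftrightarrow> (\<exists>a b. \<not> int p dvd b \<and> x = of_int a / of_int b)"
proof
  assume *: "p_integral p x"
  obtain a b where ab: "quotient_of x = (a, b)" by force
  have "\<not> int p dvd b"
    using * ab assms by (auto simp: p_integral_def dest!: coprime_common_divisor_int)
  then show "\<exists>a b. \<not> int p dvd b \<and> x = of_int a / of_int b"
    using quotient_of_div[OF ab] by blast
next
  assume "\<exists>a b. \<not> int p dvd b \<and> x = of_int a / of_int b"
  then obtain a b where b: "\<not> int p dvd b" and x: "x = of_int a / of_int b" by blast
  obtain c d where cd: "quotient_of x = (c, d)" by force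
  have "d > 0" "coprime c d" "b \<noteq> 0"
    using quotient_of_denom_pos[OF cd] quotient_of_coprime[OF cd] b by auto
  moreover have "of_int (a * d) = (of_int (c * b) :: rat)"
    using x quotient_of_div[OF cd] \<open>b \<noteq> 0\<close> \<open>d > 0\<close> by (simp add: field_simps)
  \<comment> \<open>The denominator in lowest terms divides every other denominator.\<close>
  ultimately have "d dvd b"
    by (metis coprime_commute coprime_dvd_mult_right_iff dvd_triv_right of_int_eq_iff)
  then have "\<not> int p dvd d"
    using b dvd_trans by blast
  then show "p_integral p x"
    using assms prime_imp_coprime[of "int p" d] by (simp add: p_integral_def cd coprime_commute)
qed

text \<open>The rationals whose denominator is prime to \<open>p\<close> form a local ring;
  \<open>\<P> r\<close> is the \<open>r\<close>-th power of its maximal ideal.\<close>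

locale prime_localization =
  fixes p :: nat
  assumes prime_p: "prime p"
begin

definition ideal_power :: "nat \<Rightarrow> rat set"  ("\<P>") where
  "\<P> r = {x. p_integral p (x / of_nat p ^ r)}"

lemma p_pos [simp]: "p > 0" and p_nonzero [simp]: "p \<noteq> 0"
  using prime_p prime_gt_0_nat by auto

lemma rat_cong_iff: "rat_cong a b p r \<longleftrightarrow> a \<in> \<P> 0 \<and> b \<in> \<P> 0 \<and> a - b \<in> \<P> r"
  by (simp add: rat_cong_def ideal_power_def)

lemma p_integral_add: "p_integral p x \<Longrightarrow> p_integral p y \<Longrightarrow> p_integral p (x + y)"
proof -
  assume "p_integral p x" "p_integral p y"
  then obtain a b c d where "\<not> int p dvd b" "x = of_int a / of_int b"
      "\<not> int p dvd d" "y = of_int c / of_int d"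
    unfolding p_integral_iff[OF prime_p] by blast
  then have "\<not> int p dvd b * d \<and> x + y = of_int (a * d + c * b) / of_int (b * d)"
    using prime_p by (cases "b = 0"; cases "d = 0") (auto simp: prime_dvd_mult_iff add_frac_eq)
  then show ?thesis unfolding p_integral_iff[OF prime_p] by blast
qed

lemma p_integral_mult: "p_integral p x \<Longrightarrow> p_integral p y \<Longrightarrow> p_integral p (x * y)"
proof -
  assume "p_integral p x" "p_integral p y"
  then obtain a b c d where "\<not> int p dvd b" "x = of_int a / of_int b"
      "\<not> int p dvd d" "y = of_int c / of_int d"
    unfolding p_integral_iff[OF prime_p] by blast
  then have "\<not> int p dvd b * d \<and> x * y = of_int (a * c) / of_int (b * d)"
    using prime_p by (auto simp: prime_dvd_mult_iff)
  then show ?thesis unfolding p_integral_iff[OF prime_p] by blast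
qed

lemma p_integral_of_int: "p_integral p (of_int a)"
  by (simp add: p_integral_def)

lemma of_int_ideal_0 [simp]: "of_int a \<in> \<P> 0"
  by (simp add: ideal_power_def p_integral_of_int)

lemma of_nat_ideal_0 [simp]: "of_nat n \<in> \<P> 0"
  using of_int_ideal_0[of "int n"] by simp

lemma numeral_ideal_0 [simp]: "numeral n \<in> \<P> 0"
  using of_nat_ideal_0[of "numeral n"] by simp

lemma one_ideal_0 [simp]: "1 \<in> \<P> 0"
  using of_nat_ideal_0[of 1] by simp

lemma zero_ideal [simp]: "0 \<in> \<P> r"
  using of_nat_ideal_0[of 0] by (simp add: ideal_power_def)

lemma ideal_add: "x \<in> \<P> r \<Longrightarrow> y \<in> \<P> r \<Longrightarrow> x + y \<in> \<P> r"
  by (simp add: ideal_power_def add_divide_distrib p_integral_add)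

lemma ideal_mult:
  assumes "x \<in> \<P> r" "y \<in> \<P> s"
  shows "x * y \<in> \<P> (r + s)"
proof -
  have eq: "x * y / of_nat p ^ (r + s) = (x / of_nat p ^ r) * (y / of_nat p ^ s)"
    by (simp add: power_add)
  show ?thesis
    using assms unfolding ideal_power_def mem_Collect_eq eq by (rule p_integral_mult)
qed

lemma ideal_mult_eq: "x \<in> \<P> r \<Longrightarrow> y \<in> \<P> s \<Longrightarrow> t = r + s \<Longrightarrow> x * y \<in> \<P> t"
  by (simp add: ideal_mult)

lemma ideal_mult_left: "c \<in> \<P> 0 \<Longrightarrow> x \<in> \<P> r \<Longrightarrow> c * x \<in> \<P> r"
  and ideal_mult_right: "x \<in> \<P> r \<Longrightarrow> c \<in> \<P> 0 \<Longrightarrow> x * c \<in> \<P> r"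
  using ideal_mult[of c 0 x r] ideal_mult[of x r c 0] by auto

lemma ideal_uminus: "x \<in> \<P> r \<Longrightarrow> - x \<in> \<P> r"
  using ideal_mult_left[of "-1" x r] of_int_ideal_0[of "-1"] by simp

lemma ideal_diff: "x \<in> \<P> r \<Longrightarrow> y \<in> \<P> r \<Longrightarrow> x - y \<in> \<P> r"
  using ideal_add[of x r "- y"] ideal_uminus[of y r] by simp

lemma ideal_p_power [simp]: "of_nat p ^ r \<in> \<P> r"
  using one_ideal_0 by (simp add: ideal_power_def)

lemma ideal_p: "of_nat p \<in> \<P> 1"
  using ideal_p_power[of 1] by simp

lemmas ideal_p_Suc_0 [simp] = ideal_p[unfolded One_nat_def]

lemma ideal_mono:
  assumes "x \<in> \<P> r" "s \<le> r"
  shows "x \<in> \<P> s"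
proof -
  have eq: "x / of_nat p ^ s = x / of_nat p ^ r * of_nat (p ^ (r - s))"
    using assms(2) by (simp add: field_simps flip: power_add)
  show ?thesis
    using assms(1) of_nat_ideal_0[of "p ^ (r - s)"]
    unfolding ideal_power_def mem_Collect_eq eq power_0 div_by_1 by (rule p_integral_mult)
qed

lemma ideal_sum: "(\<And>i. i \<in> A \<Longrightarrow> f i \<in> \<P> r) \<Longrightarrow> sum f A \<in> \<P> r"
  by (induction A rule: infinite_finite_induct) (auto intro: ideal_add)

lemma ideal_power_0: "x \<in> \<P> 0 \<Longrightarrow> x ^ n \<in> \<P> 0"
  by (induction n) (auto intro: ideal_mult_left)

lemma inverse_of_nat_ideal_0:
  assumes "\<not> p dvd n"
  shows "1 / of_nat n \<in> \<P> 0"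
proof -
  have "\<not> int p dvd int n \<and> 1 / of_nat n = of_int 1 / (of_int (int n) :: rat)"
    using assms by simp
  then show ?thesis unfolding ideal_power_def mem_Collect_eq p_integral_iff[OF prime_p]
    by (intro exI[of _ 1] exI[of _ "int n"]) simp
qed

lemma divide_of_nat_ideal: "x \<in> \<P> r \<Longrightarrow> \<not> p dvd n \<Longrightarrow> x / of_nat n \<in> \<P> r"
  using ideal_mult_right[OF _ inverse_of_nat_ideal_0] by fastforce

text \<open>Integers prime to \<open>p\<close> are units of the local ring. Congruences below are
  proved after multiplication by such an integer, which keeps the algebra free of
  denominators.\<close>

lemma ideal_cancel_of_nat:
  assumes "of_nat n * x \<in> \<P> r" "\<not> p dvd n"
  shows "x \<in> \<P> r"
proof -
  have "n \<noteq> 0" using assms(2) by (cases n) auto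
  then show ?thesis using divide_of_nat_ideal[OF assms] by simp
qed

lemma not_dvd_of_less: "0 < n \<Longrightarrow> n < p \<Longrightarrow> \<not> p dvd n"
  using nat_dvd_not_less by blast

lemma divide_p_power_ideal: "x \<in> \<P> (r + s) \<Longrightarrow> x / of_nat p ^ s \<in> \<P> r"
  by (simp add: ideal_power_def power_add mult.commute)

section \<open>Power sums and harmonic sums modulo p\<close>

lemma fermat_ideal:
  assumes "\<not> p dvd n"
  shows "of_nat n ^ (p - 1) - 1 \<in> \<P> 1"
proof -
  have "[n ^ (p - 1) = 1] (mod p)"
    using fermat_theorem[OF prime_p assms] .
  then have "[int (n ^ (p - 1)) = int 1] (mod int p)"
    by (simp only: cong_int_iff)
  then have "int p dvd int (n ^ (p - 1)) - int 1"
    by (simp only: cong_iff_dvd_diff)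
  then obtain z where z: "int (n ^ (p - 1)) - int 1 = int p * z" ..
  have "of_nat n ^ (p - 1) - 1 = (of_int (int (n ^ (p - 1)) - int 1) :: rat)"
    by simp
  also have "\<dots> = of_nat p * of_int z"
    unfolding z by simp
  finally show ?thesis
    using ideal_mult_right[OF ideal_p of_int_ideal_0] by simp
qed

text \<open>The recurrence expresses (n+1) B_n through earlier Bernoulli numbers, and n+1 is a unit
  since it is below \<open>p\<close>.\<close>

lemma bernoulli_num_ideal:
  assumes "n + 1 < p"
  shows "bernoulli_num n \<in> \<P> 0"
  using assms
proof (induction n rule: less_induct)
  case (less n)
  have "of_nat (Suc n) * bernoulli_num n
      = (if n = 0 then 1 else 0) - (\<Sum>i<n. of_nat (Suc n choose i) * bernoulli_num i)"
    using bernoulli_num_recurrence[of n] by (simp add: lessThan_Suc_atMost[symmetric] algebra_simps)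
  also have "\<dots> \<in> \<P> 0"
    using less by (intro ideal_diff ideal_sum ideal_mult_left) auto
  finally show ?case
    by (rule ideal_cancel_of_nat) (use less.prems in \<open>auto intro: not_dvd_of_less\<close>)
qed

text \<open>Every term of Faulhaber's formula at k = p carries a positive power of \<open>p\<close>,
  with p-integral Bernoulli numbers.\<close>

lemma faulhaber_ideal:
  assumes "s + 1 < p"
  shows "(\<Sum>j<p. of_nat j ^ s) \<in> \<P> 1"
proof (rule ideal_cancel_of_nat)
  have "of_nat (Suc s) * (\<Sum>j<p. of_nat j ^ s :: rat)
    = (\<Sum>i\<le>s. of_nat (Suc s choose i) * bernoulli_num i * of_nat p ^ (Suc s - i))"
    unfolding faulhaber by simp
  also have "\<dots> \<in> \<P> 1"
    using assms
    by (intro ideal_sum ideal_mult_left bernoulli_num_ideal)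
       (auto intro: ideal_mono[OF ideal_p_power])
  finally show "of_nat (Suc s) * (\<Sum>j<p. of_nat j ^ s :: rat) \<in> \<P> 1" .
  show "\<not> p dvd Suc s"
    using assms by (intro not_dvd_of_less) auto
qed

lemma power_sum_ideal:
  assumes "0 < s" "s < p - 1"
  shows "(\<Sum>j = 1..p - 1. of_nat j ^ s) \<in> \<P> 1"
proof -
  have "{..<p} = insert 0 {1..p - 1}" using p_pos by auto
  then show ?thesis
    using faulhaber_ideal[of s] assms by (simp add: zero_power)
qed

lemma inverse_power_ideal_0:
  assumes "j \<in> {1..p - 1}"
  shows "1 / of_nat j ^ r \<in> \<P> 0"
proof -
  have "\<not> p dvd j" using assms by (intro not_dvd_of_less) auto
  then show ?thesis
    using ideal_power_0[OF inverse_of_nat_ideal_0, of j r] by (simp add: power_divide)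
qed

lemma divide_power_ideal: "x \<in> \<P> s \<Longrightarrow> j \<in> {1..p - 1} \<Longrightarrow> x / of_nat j ^ r \<in> \<P> s"
  using ideal_mult_right[OF _ inverse_power_ideal_0, of x s j r] by simp

text \<open>Fermat's little theorem turns negative exponents into nonnegative ones, to which
  Faulhaber's formula applies.\<close>

lemma inverse_power_cong:
  assumes j: "j \<in> {1..p - 1}" and r: "r \<le> p - 1"
  shows "1 / of_nat j ^ r - of_nat j ^ (p - 1 - r) \<in> \<P> 1"
proof -
  have *: "\<not> p dvd j" using j by (intro not_dvd_of_less) auto
  obtain s where s: "p - 1 = r + s" using r le_Suc_ex by blast
  have "1 / of_nat j ^ r - of_nat j ^ (p - 1 - r) = - (of_nat j ^ (p - 1) - 1) / (of_nat j ^ r :: rat)"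
    unfolding s using j by (simp add: power_add field_simps)
  also have "\<dots> \<in> \<P> 1"
    using j by (intro divide_power_ideal ideal_uminus fermat_ideal *)
  finally show ?thesis .
qed

lemma power_harmonic_ideal_0: "N < p \<Longrightarrow> power_harmonic N r \<in> \<P> 0"
  unfolding power_harmonic_def by (intro ideal_sum inverse_power_ideal_0) auto

lemma power_harmonic_ideal_1:
  assumes "0 < r" "r < p - 1"
  shows "power_harmonic (p - 1) r \<in> \<P> 1"
proof -
  have "power_harmonic (p - 1) r = (\<Sum>j = 1..p - 1. 1 / of_nat j ^ r - of_nat j ^ (p - 1 - r))
      + (\<Sum>j = 1..p - 1. of_nat j ^ (p - 1 - r))"
    by (simp add: power_harmonic_def sum_subtractf)
  also have "\<dots> \<in> \<P> 1"
    using assms by (intro ideal_add ideal_sum inverse_power_cong power_sum_ideal) auto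
  finally show ?thesis .
qed

lemma rat_congI: "b \<in> \<P> 0 \<Longrightarrow> a - b \<in> \<P> r \<Longrightarrow> rat_cong a b p r"
  using ideal_add[of b 0 "a - b"] ideal_mono[of "a - b" r 0] by (simp add: rat_cong_iff)

text \<open>Fermat replaces the inner sum by a sum of j^s, which Faulhaber expands as a polynomial
  in \<open>k\<close>. The outer sum of a power of \<open>k\<close> vanishes modulo \<open>p\<close>
  unless the exponent is 0, where it is p - 1, that is -1; so only the term with Bernoulli index p -
  a - b survives.\<close>

lemma double_power_harmonic_cong:
  assumes "1 \<le> a" "1 \<le> b" "a + b \<le> p - 1"
  shows "of_nat (p - a) * (\<Sum>k = 1..p - 1. power_harmonic (k - 1) a / of_nat k ^ b)
     + of_nat ((p - a) choose b) * bernoulli_num (p - a - b) \<in> \<P> 1"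
proof -
  define s where "s = p - 1 - a"
  have s: "s \<ge> 1" "p - a = Suc s" "b \<le> s" "s + 1 < p"
    using assms by (auto simp: s_def)
  define c where "c i = of_nat (Suc s choose i) * bernoulli_num i" for i
  \<comment> \<open>Kept as a quotient because the total exponent of \<open>k\<close> can be
    negative.\<close>
  define E where "E i = (\<Sum>k = 1..p - 1. of_nat k ^ (Suc s - i) / of_nat k ^ b :: rat)" for i
  define S where "S = (\<Sum>k = 1..p - 1. (\<Sum>j<k. of_nat j ^ s) / of_nat k ^ b :: rat)"
  define D where "D = (\<Sum>k = 1..p - 1. power_harmonic (k - 1) a / of_nat k ^ b)"
  have c: "c i \<in> \<P> 0" if "i \<le> s" for i
    using that s unfolding c_def by (intro ideal_mult_left bernoulli_num_ideal) auto
  have "D - S = (\<Sum>k = 1..p - 1. (\<Sum>j = 1..k - 1. 1 / of_nat j ^ a - of_nat j ^ s) / of_nat k ^ b)"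
    unfolding D_def S_def sum_subtractf[symmetric]
  proof (intro sum.cong refl)
    fix k assume "k \<in> {1..p - 1}"
    then have "{..<k} = insert 0 {1..k - 1}" by auto
    then have "(\<Sum>j<k. of_nat j ^ s :: rat) = (\<Sum>j = 1..k - 1. of_nat j ^ s)"
      using s by (simp add: zero_power)
    then show "power_harmonic (k - 1) a / of_nat k ^ b - (\<Sum>j<k. of_nat j ^ s) / of_nat k ^ b
        = (\<Sum>j = 1..k - 1. 1 / of_nat j ^ a - of_nat j ^ s) / of_nat k ^ b"
      by (simp add: power_harmonic_def sum_subtractf diff_divide_distrib)
  qed
  also have "\<dots> \<in> \<P> 1"
    unfolding s_def using assms
    by (intro ideal_sum divide_power_ideal inverse_power_cong) auto
  finally have DS: "D - S \<in> \<P> 1" .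
  have "of_nat (Suc s) * S
      = (\<Sum>k = 1..p - 1. \<Sum>i\<le>s. c i * (of_nat k ^ (Suc s - i) / of_nat k ^ b))"
    unfolding S_def sum_distrib_left
  proof (intro sum.cong refl)
    fix k
    have "of_nat (Suc s) * ((\<Sum>j<k. of_nat j ^ s) / of_nat k ^ b :: rat)
        = (of_nat (Suc s) * (\<Sum>j<k. of_nat j ^ s)) / of_nat k ^ b"
      by (simp only: times_divide_eq_right)
    also have "of_nat (Suc s) * (\<Sum>j<k. of_nat j ^ s :: rat) = (\<Sum>i\<le>s. c i * of_nat k ^ (Suc s - i))"
      unfolding faulhaber c_def by simp
    finally show "of_nat (Suc s) * ((\<Sum>j<k. of_nat j ^ s) / of_nat k ^ b :: rat)
        = (\<Sum>i\<le>s. c i * (of_nat k ^ (Suc s - i) / of_nat k ^ b))"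
      by (simp add: sum_divide_distrib)
  qed
  also have "\<dots> = (\<Sum>i\<le>s. c i * E i)"
    unfolding E_def sum_distrib_left by (rule sum.swap)
  finally have S: "of_nat (Suc s) * S = (\<Sum>i\<le>s. c i * E i)" .
  \<comment> \<open>The cases are positive, negative and zero total exponent; all nonzero exponents
    are smaller than p - 1 in absolute value.\<close>
  have E: "E i + (if i = Suc s - b then 1 else 0) \<in> \<P> 1" if "i \<le> s" for i
  proof -
    consider "Suc s - i > b" | "Suc s - i < b" | "Suc s - i = b" by linarith
    then show ?thesis
    proof cases
      case 1
      define d where "d = Suc s - i - b"
      have d: "Suc s - i = b + d" using 1 by (simp add: d_def)
      have "E i = (\<Sum>k = 1..p - 1. of_nat k ^ d)"
        unfolding E_def d by (intro sum.cong) (auto simp: power_add)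
      also have "\<dots> \<in> \<P> 1"
        using 1 d s assms by (intro power_sum_ideal) auto
      finally show ?thesis using 1 by auto
    next
      case 2
      then have "E i = power_harmonic (p - 1) (b - (Suc s - i))"
        unfolding E_def power_harmonic_def by (intro sum.cong) (auto simp: power_diff)
      also have "\<dots> \<in> \<P> 1"
        using 2 assms by (intro power_harmonic_ideal_1) auto
      finally show ?thesis using 2 that s by auto
    next
      case 3
      then have "E i = (\<Sum>k = 1..p - 1. 1)"
        unfolding E_def by (intro sum.cong) auto
      then have "E i + 1 = of_nat p"
        by (simp add: of_nat_diff Suc_leI)
      then show ?thesis using 3 that by auto
    qed
  qed
  have "(\<Sum>i\<le>s. c i * (E i + (if i = Suc s - b then 1 else 0)))
      = (\<Sum>i\<le>s. c i * E i + (if i = Suc s - b then c i else 0))"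
    by (intro sum.cong) (auto simp: distrib_left)
  also have "\<dots> = of_nat (Suc s) * S + c (Suc s - b)"
    using assms(2) by (simp only: sum.distrib S) (simp add: sum.delta)
  finally have "of_nat (Suc s) * D + c (Suc s - b)
      = of_nat (Suc s) * (D - S) + (\<Sum>i\<le>s. c i * (E i + (if i = Suc s - b then 1 else 0)))"
    by (simp only: right_diff_distrib)
  also have "\<dots> \<in> \<P> 1"
    by (intro ideal_add ideal_mult_left of_nat_ideal_0 DS ideal_sum c E) auto
  finally have "of_nat (Suc s) * D + c (Suc s - b) \<in> \<P> 1" .
  moreover have "c (Suc s - b) = of_nat (Suc s choose b) * bernoulli_num (Suc s - b)"
    unfolding c_def using s binomial_symmetric[of b "Suc s"] by simp
  ultimately show ?thesis
    unfolding D_def s(2) by simp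
qed

text \<open>Binomial expansion to second order. In the induction the only new error is the quadratic
  term times \<open>y\<close>, which has order three; halving needs \<open>p\<close> odd.\<close>

lemma one_minus_power_cong:
  assumes "y \<in> \<P> 1" "p \<noteq> 2"
  shows "(1 - y) ^ e - (1 - of_nat e * y + of_nat e * (of_nat e - 1) / 2 * y ^ 2) \<in> \<P> 3"
proof (induction e)
  case (Suc e)
  have "\<not> p dvd 2"
    using assms(2) prime_p two_is_prime_nat primes_dvd_imp_eq by blast
  moreover have "of_nat e * (of_nat e - 1) \<in> \<P> 0"
    by (intro ideal_mult_left ideal_diff) auto
  ultimately have half: "of_nat e * (of_nat e - 1) / 2 \<in> \<P> 0"
    using divide_of_nat_ideal[of "of_nat e * (of_nat e - 1)" 0 2] by simp
  have "(1 - y) ^ Suc e - (1 - of_nat (Suc e) * y + of_nat (Suc e) * (of_nat (Suc e) - 1) / 2 * y ^ 2)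
      = (1 - y) * ((1 - y) ^ e - (1 - of_nat e * y + of_nat e * (of_nat e - 1) / 2 * y ^ 2))
        - of_nat e * (of_nat e - 1) / 2 * (y * (y * y))"
    by (simp add: field_simps power2_eq_square)
  also have "\<dots> \<in> \<P> 3"
  proof (rule ideal_diff)
    show "(1 - y) * ((1 - y) ^ e - (1 - of_nat e * y + of_nat e * (of_nat e - 1) / 2 * y ^ 2)) \<in> \<P> 3"
      using ideal_mono[OF assms(1), of 0] by (intro ideal_mult_left[OF _ Suc] ideal_diff) auto
    show "of_nat e * (of_nat e - 1) / 2 * (y * (y * y)) \<in> \<P> 3"
      using assms(1)
      by (intro ideal_mult_left[OF half] ideal_mult_eq[of y 1 "y * y" 2] ideal_mult_eq[of y 1 y 1]) auto
  qed
  finally show ?case .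
qed simp

section \<open>Reduction to m = 1\<close>

text \<open>The sign is absorbed so that the value becomes a product of factors congruent to 1
  modulo \<open>p\<close> when k < p and \<open>m\<close> is prime to \<open>p\<close>.\<close>

definition signed_power :: "nat \<Rightarrow> nat \<Rightarrow> rat" where
  "signed_power m k = (- 1) ^ (k * m) * ((of_nat p / of_nat m - 1) gchoose k) ^ m"

lemma signed_power_prod:
  "signed_power m k = (\<Prod>j = 1..k. 1 - of_nat p / of_nat m / of_nat j) ^ m"
  by (simp only: signed_power_def power_mult flip: gbinomial_minus_one_prod power_mult_distrib)

lemma signed_power_0 [simp]: "signed_power m 0 = 1"
  by (simp add: signed_power_prod)

lemma signed_power_Suc:
  "signed_power m (Suc k) = signed_power m k * (1 - of_nat p / of_nat (Suc k) / of_nat m) ^ m"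
  by (simp add: signed_power_prod power_mult_distrib mult.commute)

lemma p_divide_ideal: "\<not> p dvd n \<Longrightarrow> of_nat p / of_nat n \<in> \<P> 1"
  using divide_of_nat_ideal[OF ideal_p] .

text \<open>First-order expansion of the product: each induction step adds a cross term with two
  factors divisible by \<open>p\<close>.\<close>

lemma signed_power_1_cong:
  assumes "k < p"
  shows "signed_power 1 k - (1 - of_nat p * power_harmonic k 1) \<in> \<P> 2"
  using assms
proof (induction k)
  case (Suc k)
  define x :: rat where "x = of_nat p / of_nat (Suc k)"
  have x: "x \<in> \<P> 1"
    unfolding x_def using Suc.prems by (intro p_divide_ideal not_dvd_of_less) auto
  have s_Suc: "signed_power 1 (Suc k) = signed_power 1 k * (1 - x)"
    by (simp add: signed_power_Suc x_def)
  have pH_Suc: "of_nat p * power_harmonic (Suc k) 1 = of_nat p * power_harmonic k 1 + x"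
    by (simp add: power_harmonic_Suc x_def distrib_left)
  have "signed_power 1 (Suc k) - (1 - of_nat p * power_harmonic (Suc k) 1)
      = (signed_power 1 k - (1 - of_nat p * power_harmonic k 1)) * (1 - x)
        + (of_nat p * power_harmonic k 1) * x"
    unfolding s_Suc pH_Suc by (simp add: algebra_simps)
  also have "\<dots> \<in> \<P> 2"
  proof (rule ideal_add)
    show "(signed_power 1 k - (1 - of_nat p * power_harmonic k 1)) * (1 - x) \<in> \<P> 2"
      using Suc ideal_mono[OF x, of 0] by (intro ideal_mult_right ideal_diff[of 1]) auto
    show "of_nat p * power_harmonic k 1 * x \<in> \<P> 2"
      using Suc.prems
      by (intro ideal_mult_eq[OF ideal_mult_right[OF ideal_p] x] power_harmonic_ideal_0) auto
  qed
  finally show ?case .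
qed simp

lemma signed_power_1_cong_1:
  assumes "k < p"
  shows "signed_power 1 k - 1 \<in> \<P> 1"
proof -
  have "signed_power 1 k - 1 = signed_power 1 k - (1 - of_nat p * power_harmonic k 1)
      - of_nat p * power_harmonic k 1"
    by simp
  also have "\<dots> \<in> \<P> 1"
    using assms
    by (intro ideal_diff ideal_mono[OF signed_power_1_cong] ideal_mult_right ideal_p power_harmonic_ideal_0) auto
  finally show ?thesis .
qed

text \<open>Only the quadratic term of \<open>(1 - x/m)\<^sup>m\<close> depends on \<open>m\<close>, which reduces the sums
  modulo \<open>p\<^sup>3\<close> to the case \<open>m = 1\<close>.\<close>
lemma signed_power_cong:
  assumes "k < p" "\<not> p dvd m" "p \<noteq> 2"
  shows "signed_power m k - (signed_power 1 k
      + of_nat p ^ 2 * ((of_nat m - 1) / (2 * of_nat m) * power_harmonic k 2)) \<in> \<P> 3"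
  using assms(1)
proof (induction k)
  case (Suc k)
  \<comment> \<open>The coefficient of x^2 in (1 - x/m)^m; the linear coefficient is -1 for every
    \<open>m\<close>.\<close>
  define c :: rat where "c = (of_nat m - 1) / (2 * of_nat m)"
  define x :: rat where "x = of_nat p / of_nat (Suc k)"
  define f where "f = (1 - x / of_nat m) ^ m"
  define H where "H = power_harmonic k 2"
  have m: "m \<noteq> 0" using assms(2) by (cases m) auto
  have "\<not> p dvd 2"
    using assms(3) prime_p two_is_prime_nat primes_dvd_imp_eq by blast
  then have "\<not> p dvd 2 * m"
    using assms(2) prime_p prime_dvd_mult_iff by blast
  then have c: "c \<in> \<P> 0"
    unfolding c_def using divide_of_nat_ideal[of "of_nat m - 1" 0 "2 * m"] ideal_diff[of "of_nat m" 0 1]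
    by simp
  have x: "x \<in> \<P> 1"
    unfolding x_def using Suc.prems by (intro p_divide_ideal not_dvd_of_less) auto
  have H: "H \<in> \<P> 0"
    unfolding H_def using Suc.prems by (intro power_harmonic_ideal_0) auto
  have "f - (1 - of_nat m * (x / of_nat m) + of_nat m * (of_nat m - 1) / 2 * (x / of_nat m) ^ 2) \<in> \<P> 3"
    unfolding f_def using assms x by (intro one_minus_power_cong divide_of_nat_ideal)
  also have "1 - of_nat m * (x / of_nat m) + of_nat m * (of_nat m - 1) / 2 * (x / of_nat m) ^ 2
      = 1 - x + c * x ^ 2"
    using m by (simp add: c_def field_simps power2_eq_square)
  finally have f: "f - (1 - x + c * x ^ 2) \<in> \<P> 3" .
  have x2: "x ^ 2 \<in> \<P> 2"
    unfolding power2_eq_square using x by (intro ideal_mult_eq) auto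
  have "1 - x + c * x ^ 2 \<in> \<P> 0"
    using ideal_mono[OF x, of 0] ideal_mono[OF x2, of 0] c
    by (intro ideal_add ideal_diff ideal_mult_left) auto
  then have f0: "f \<in> \<P> 0"
    using ideal_add[OF ideal_mono[OF f, of 0]] by fastforce
  have s: "signed_power 1 k - 1 \<in> \<P> 1"
    using Suc.prems by (intro signed_power_1_cong_1) simp
  then have s0: "signed_power 1 k \<in> \<P> 0"
    using ideal_add[OF ideal_mono[OF s, of 0] one_ideal_0] by simp
  have s_Suc: "signed_power m (Suc k) = signed_power m k * f"
      "signed_power 1 (Suc k) = signed_power 1 k * (1 - x)"
    by (simp_all add: signed_power_Suc x_def f_def)
  have pH_Suc: "of_nat p ^ 2 * (c * power_harmonic (Suc k) 2) = of_nat p ^ 2 * (c * H) + c * x ^ 2"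
    by (simp add: power_harmonic_Suc x_def H_def distrib_left power_divide)
  have "signed_power m (Suc k) - (signed_power 1 (Suc k) + of_nat p ^ 2 * (c * power_harmonic (Suc k) 2))
      = signed_power m k * f - (signed_power 1 k * (1 - x) + (of_nat p ^ 2 * (c * H) + c * x ^ 2))"
    unfolding s_Suc pH_Suc ..
  \<comment> \<open>Two summands carry an error of order three, one from the induction and one from
    the new factor; the other two are products of orders 1 + 2 and 2 + 1.\<close>
  also have "\<dots> = (signed_power m k - (signed_power 1 k + of_nat p ^ 2 * (c * H))) * f
      + (signed_power 1 k + of_nat p ^ 2 * (c * H)) * (f - (1 - x + c * x ^ 2))
      + (c * (signed_power 1 k - 1)) * x ^ 2 + (of_nat p ^ 2 * (c * H)) * (c * x ^ 2 - x)"
    by (simp add: algebra_simps)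
  also have "\<dots> \<in> \<P> 3"
  proof (intro ideal_add)
    show "(signed_power m k - (signed_power 1 k + of_nat p ^ 2 * (c * H))) * f \<in> \<P> 3"
      using Suc f0 unfolding c_def H_def by (intro ideal_mult_right) auto
    show "(signed_power 1 k + of_nat p ^ 2 * (c * H)) * (f - (1 - x + c * x ^ 2)) \<in> \<P> 3"
      using f c H s0 by (intro ideal_mult_left ideal_add ideal_power_0) auto
    show "(c * (signed_power 1 k - 1)) * x ^ 2 \<in> \<P> 3"
      using c s x2 by (intro ideal_mult_eq[of _ 1 _ 2] ideal_mult_left) auto
    show "(of_nat p ^ 2 * (c * H)) * (c * x ^ 2 - x) \<in> \<P> 3"
    proof (rule ideal_mult_eq[of _ 2 _ 1])
      show "of_nat p ^ 2 * (c * H) \<in> \<P> 2"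
        using c H by (intro ideal_mult_right ideal_mult_left) auto
      show "c * x ^ 2 - x \<in> \<P> 1"
        using c x ideal_mono[OF x2, of 1] by (intro ideal_diff ideal_mult_left) auto
    qed simp
  qed
  finally show ?case
    by (simp add: c_def)
qed simp

lemma signed_power_1: "signed_power 1 k = (- 1) ^ k * of_nat ((p - 1) choose k)"
proof -
  have eq: "of_nat p / of_nat 1 - 1 = (of_nat (p - 1) :: rat)"
    by (simp add: Suc_leI)
  show ?thesis
    unfolding signed_power_def eq binomial_gbinomial[symmetric] mult_1_right power_one_right ..
qed

lemma signed_power_1_sum:
  assumes "r > 0"
  shows "(\<Sum>k = 1..p - 1. signed_power 1 k / of_nat k ^ r) = - complete_harmonic (p - 1) r"
  using alternating_binomial_sum_complete_harmonic[of "p - 1" r] assms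
  by (simp only: signed_power_1 simp_thms)

text \<open>All three final congruences start here: the sum is -h_r plus a correction in
  \<open>m\<close> whose double sum is needed only modulo \<open>p\<close>.\<close>

lemma signed_power_sum_cong:
  assumes "r > 0" "\<not> p dvd m" "p \<noteq> 2"
  shows "(\<Sum>k = 1..p - 1. signed_power m k / of_nat k ^ r) + complete_harmonic (p - 1) r
      - of_nat p ^ 2 * ((of_nat m - 1) / (2 * of_nat m)
          * (\<Sum>k = 1..p - 1. power_harmonic k 2 / of_nat k ^ r)) \<in> \<P> 3"
proof -
  define q where "q = of_nat p ^ 2 * ((of_nat m - 1) / (2 * of_nat m) :: rat)"
  define f where "f k = signed_power m k - (signed_power 1 k + q * power_harmonic k 2)" for k
  have "(\<Sum>k = 1..p - 1. f k / of_nat k ^ r) \<in> \<P> 3"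
    unfolding f_def q_def mult.assoc using assms
    by (intro ideal_sum divide_power_ideal signed_power_cong) auto
  also have "(\<Sum>k = 1..p - 1. f k / of_nat k ^ r)
      = (\<Sum>k = 1..p - 1. signed_power m k / of_nat k ^ r)
        - ((\<Sum>k = 1..p - 1. signed_power 1 k / of_nat k ^ r)
          + (\<Sum>k = 1..p - 1. q * (power_harmonic k 2 / of_nat k ^ r)))"
    unfolding sum.distrib[symmetric] sum_subtractf[symmetric] f_def
    by (intro sum.cong refl) (simp only: diff_divide_distrib add_divide_distrib times_divide_eq_right)
  also have "(\<Sum>k = 1..p - 1. q * (power_harmonic k 2 / of_nat k ^ r))
      = q * (\<Sum>k = 1..p - 1. power_harmonic k 2 / of_nat k ^ r)"
    by (rule sum_distrib_left[symmetric])
  finally show ?thesis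
    unfolding signed_power_1_sum[OF assms(1)] q_def by (simp only: diff_diff_eq[symmetric] diff_minus_eq_add mult.assoc)
qed

section \<open>Harmonic sums modulo powers of p\<close>

lemma complete_harmonic_ideal_0: "N < p \<Longrightarrow> complete_harmonic N r \<in> \<P> 0"
proof (induction N r rule: complete_harmonic.induct)
  case (3 N r)
  then show ?case
    by (auto simp del: of_nat_Suc intro!: ideal_add divide_of_nat_ideal not_dvd_of_less)
qed simp_all

text \<open>Write H_r and h_r for the power sum and the complete homogeneous polynomial with N = p -
  1. Each term of Newton's identity contains some H_i divisible by \<open>p\<close>, and the factor
  \<open>r\<close> is a unit.\<close>

lemma complete_harmonic_ideal_1:
  assumes "0 < r" "r < p - 1"
  shows "complete_harmonic (p - 1) r \<in> \<P> 1"
proof -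
  obtain q where q: "r = Suc q" using assms(1) gr0_conv_Suc by blast
  have "of_nat (Suc q) * complete_harmonic (p - 1) (Suc q) \<in> \<P> 1"
    unfolding complete_harmonic_newton using assms q
    by (intro ideal_sum ideal_mult_right power_harmonic_ideal_1 complete_harmonic_ideal_0) auto
  moreover have "\<not> p dvd Suc q"
    using assms q by (intro not_dvd_of_less) auto
  ultimately show ?thesis
    unfolding q by (rule ideal_cancel_of_nat)
qed

lemma complete_harmonic_newton_remainder:
  "of_nat (Suc q) * complete_harmonic N (Suc q) - power_harmonic N (Suc q)
     = (\<Sum>i<q. power_harmonic N (Suc i) * complete_harmonic N (q - i))"
  unfolding complete_harmonic_newton by (simp add: lessThan_Suc_atMost[symmetric])

text \<open>Once H_r is removed from Newton's identity, every remaining product has two factors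
  divisible by \<open>p\<close>.\<close>

lemma complete_harmonic_cong_2:
  assumes "0 < r" "r < p - 1"
  shows "of_nat r * complete_harmonic (p - 1) r - power_harmonic (p - 1) r \<in> \<P> 2"
proof -
  obtain q where q: "r = Suc q" using assms(1) gr0_conv_Suc by blast
  show ?thesis
    unfolding q complete_harmonic_newton_remainder using assms q
    by (intro ideal_sum ideal_mult_eq[of _ 1 _ 1] power_harmonic_ideal_1 complete_harmonic_ideal_1) auto
qed

lemma sum_reflect: "(\<Sum>k = 1..p - 1. f (p - k)) = (\<Sum>k = 1..p - 1. f k)"
  by (rule sum.reindex_bij_witness[of _ "\<lambda>k. p - k" "\<lambda>k. p - k"]) auto

text \<open>For odd \<open>r\<close>, 1/(p - k)^r = -(1 - p/k)^(-r) / k^r. Expanding this to second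
  order in p/k and summing over \<open>k\<close> and its reflection gives the relation.\<close>

lemma power_harmonic_reflect:
  assumes "odd r" "p \<noteq> 2"
  shows "2 * power_harmonic (p - 1) r + of_nat r * of_nat p * power_harmonic (p - 1) (r + 1)
     + of_nat r * (of_nat r + 1) / 2 * of_nat p ^ 2 * power_harmonic (p - 1) (r + 2) \<in> \<P> 3"
proof -
  define a :: rat where "a = of_nat r * (of_nat r - 1) / 2"
  define b :: rat where "b = of_nat r * (of_nat r + 1) / 2"
  have "\<not> p dvd 2"
    using assms(2) prime_p two_is_prime_nat primes_dvd_imp_eq by blast
  moreover have "of_nat r * (of_nat r - 1) \<in> \<P> 0" "of_nat r * (of_nat r + 1) \<in> \<P> 0"
    by (intro ideal_mult_left ideal_diff ideal_add; simp)+
  ultimately have ab: "a \<in> \<P> 0" "b \<in> \<P> 0"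
    using divide_of_nat_ideal[of _ 0 2] by (auto simp: a_def b_def)
  have summand: "1 / of_nat k ^ r + 1 / of_nat (p - k) ^ r + of_nat r * of_nat p * (1 / of_nat k ^ (r + 1))
      + b * of_nat p ^ 2 * (1 / of_nat k ^ (r + 2)) \<in> \<P> 3" if k: "k \<in> {1..p - 1}" for k
  proof -
    define x :: rat where "x = of_nat p / of_nat k"
    \<comment> \<open>\<open>Q\<close> and \<open>R\<close> truncate (1 - x)^(-r) and (1 - x)^r;
      since Q R is 1 up to x^3, no infinite series is needed.\<close>
    define Q where "Q = 1 + of_nat r * x + b * x ^ 2"
    define R where "R = 1 - of_nat r * x + a * x ^ 2"
    have "\<not> p dvd k" using k by (intro not_dvd_of_less) auto
    then have x: "x \<in> \<P> 1"
      unfolding x_def by (rule p_divide_ideal)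
    have x0: "x \<in> \<P> 0" using ideal_mono[OF x, of 0] by simp
    have x3: "x * (x * x) \<in> \<P> 3"
      by (intro ideal_mult_eq[OF x, of _ 2] ideal_mult_eq[OF x x]) auto
    have R: "(1 - x) ^ r - R \<in> \<P> 3"
      unfolding R_def a_def using assms x by (intro one_minus_power_cong)
    have Q: "Q \<in> \<P> 0"
      unfolding Q_def using x0 ab by (intro ideal_add ideal_mult_left ideal_power_0) auto
    have "Q * R - 1 = (of_nat r * a - of_nat r * b + a * b * x) * (x * (x * x))"
      unfolding Q_def R_def a_def b_def by (simp add: field_simps power2_eq_square)
    also have "\<dots> \<in> \<P> 3"
      using ab x0 by (intro ideal_mult_left[OF _ x3] ideal_add ideal_diff ideal_mult_left) auto
    finally have QR: "Q * R - 1 \<in> \<P> 3" .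
    have k0: "of_nat k \<noteq> (0 :: rat)" "of_nat (p - k) \<noteq> (0 :: rat)" using k by auto
    have "k \<le> p" using k by auto
    then have "of_nat (p - k) = - of_nat k * (1 - x)"
      using k0 by (simp add: x_def of_nat_diff field_simps)
    moreover from this have x1: "1 - x \<noteq> 0"
      using k0(2) by auto
    ultimately have pk: "of_nat (p - k) ^ r = - (of_nat k ^ r) * (1 - x) ^ r"
      using assms(1) by (simp add: power_mult_distrib)
    have Qk: "1 / of_nat k ^ r * Q = 1 / of_nat k ^ r + of_nat r * of_nat p * (1 / of_nat k ^ (r + 1))
      + b * of_nat p ^ 2 * (1 / of_nat k ^ (r + 2))"
      using k0(1) by (simp add: Q_def x_def field_simps power2_eq_square)
    have "1 / of_nat k ^ r * Q + 1 / of_nat (p - k) ^ r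
        = - (Q * ((1 - x) ^ r - R) + (Q * R - 1)) / of_nat (p - k) ^ r"
    proof -
      have "1 / of_nat k ^ r = - ((1 - x) ^ r) / of_nat (p - k) ^ r"
        using k0 x1 unfolding pk by simp
      then show ?thesis
        by (simp add: algebra_simps add_divide_distrib diff_divide_distrib)
    qed
    also have "\<dots> \<in> \<P> 3"
      using k by (intro divide_power_ideal ideal_uminus ideal_add ideal_mult_left[OF Q R] QR) auto
    finally show ?thesis
      unfolding Qk by (simp add: add_ac)
  qed
  have "(\<Sum>k = 1..p - 1. 1 / of_nat k ^ r + 1 / of_nat (p - k) ^ r
      + of_nat r * of_nat p * (1 / of_nat k ^ (r + 1)) + b * of_nat p ^ 2 * (1 / of_nat k ^ (r + 2))) \<in> \<P> 3"
    using summand by (intro ideal_sum)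
  then show ?thesis
    unfolding sum.distrib sum_reflect[of "\<lambda>k. 1 / of_nat k ^ r"] sum_distrib_left[symmetric]
      power_harmonic_def[symmetric] b_def
    by (simp only: mult_2)
qed

text \<open>A Wolstenholme-type congruence: modulo p^2 reflection leaves 2 H_r + r p H_(r+1), and
  the bound on \<open>r\<close> makes H_(r+1) divisible by \<open>p\<close>.\<close>

lemma power_harmonic_odd_ideal_2:
  assumes "odd r" "r + 1 < p - 1"
  shows "power_harmonic (p - 1) r \<in> \<P> 2"
proof -
  define E where "E = of_nat r * of_nat p * power_harmonic (p - 1) (r + 1)"
  define G where "G = of_nat r * (of_nat r + 1) / 2 * of_nat p ^ 2 * power_harmonic (p - 1) (r + 2)"
  have p2: "\<not> p dvd 2" using assms by (intro not_dvd_of_less) auto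
  have "of_nat r * (of_nat r + 1) \<in> \<P> 0"
    by (intro ideal_mult_left ideal_add) auto
  from divide_of_nat_ideal[OF this p2] have "of_nat r * (of_nat r + 1) / 2 \<in> \<P> 0"
    by simp
  then have G: "G \<in> \<P> 2"
    unfolding G_def by (intro ideal_mult_right[OF ideal_mult_left] power_harmonic_ideal_0) auto
  have E: "E \<in> \<P> 2"
    unfolding E_def using assms
    by (intro ideal_mult_eq[of _ 1 _ 1] ideal_mult_left power_harmonic_ideal_1) auto
  have "2 * power_harmonic (p - 1) r + E + G \<in> \<P> 3"
    unfolding E_def G_def using assms by (intro power_harmonic_reflect) auto
  from ideal_diff[OF ideal_diff[OF ideal_mono[OF this] G] E]
  have "of_nat 2 * power_harmonic (p - 1) r \<in> \<P> 2" by simp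
  then show ?thesis using p2 by (rule ideal_cancel_of_nat)
qed

text \<open>The stronger bound makes H_(r+2) divisible by \<open>p\<close>, so the quadratic term of
  the reflection disappears modulo p^3.\<close>

lemma power_harmonic_odd_cong:
  assumes "odd r" "r + 2 < p - 1"
  shows "2 * power_harmonic (p - 1) r + of_nat r * of_nat p * power_harmonic (p - 1) (r + 1) \<in> \<P> 3"
proof -
  define G where "G = of_nat r * (of_nat r + 1) / 2 * of_nat p ^ 2 * power_harmonic (p - 1) (r + 2)"
  have p2: "\<not> p dvd 2" using assms by (intro not_dvd_of_less) auto
  have "of_nat r * (of_nat r + 1) \<in> \<P> 0"
    by (intro ideal_mult_left ideal_add) auto
  from divide_of_nat_ideal[OF this p2] have "of_nat r * (of_nat r + 1) / 2 \<in> \<P> 0"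
    by simp
  then have "G \<in> \<P> 3"
    unfolding G_def using assms
    by (intro ideal_mult_eq[of _ 2 _ 1] ideal_mult_left power_harmonic_ideal_1) auto
  moreover have "2 * power_harmonic (p - 1) r
      + of_nat r * of_nat p * power_harmonic (p - 1) (r + 1) + G \<in> \<P> 3"
    unfolding G_def using assms by (intro power_harmonic_reflect) auto
  ultimately show ?thesis
    using ideal_diff by fastforce
qed

text \<open>One more power of \<open>p\<close> than the general reflection gives, because H_1 is
  later divided by \<open>p\<close>. It comes from an exact finite geometric expansion of 1/(p -
  k).\<close>

lemma power_harmonic_1_cong_4:
  assumes "p > 5"
  shows "2 * power_harmonic (p - 1) 1 + of_nat p * power_harmonic (p - 1) 2 \<in> \<P> 4"
proof -
  let ?p = "of_nat p :: rat"
  have summand: "1 / of_nat k ^ 1 + 1 / of_nat (p - k) ^ 1 + ?p * (1 / of_nat k ^ 2)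
      + ?p ^ 2 * (1 / of_nat k ^ 3) + ?p ^ 3 * (1 / of_nat k ^ 4) \<in> \<P> 4"
    if k: "k \<in> {1..p - 1}" for k
  proof -
    have k0: "of_nat k \<noteq> (0 :: rat)" "?p - of_nat k \<noteq> 0" using k by auto
    have "k \<le> p" using k by auto
    then have pk: "of_nat (p - k) = ?p - of_nat k"
      by (simp add: of_nat_diff)
    have "1 / of_nat k ^ 1 + 1 / of_nat (p - k) ^ 1 + ?p * (1 / of_nat k ^ 2)
        + ?p ^ 2 * (1 / of_nat k ^ 3) + ?p ^ 3 * (1 / of_nat k ^ 4)
        = ?p ^ 4 / of_nat k ^ 4 / of_nat (p - k) ^ 1"
      unfolding pk using k0 by (simp add: divide_simps) (simp add: algebra_simps eval_nat_numeral)
    also have "\<dots> \<in> \<P> 4"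
      using k by (intro divide_power_ideal ideal_p_power) auto
    finally show ?thesis .
  qed
  have "(\<Sum>k = 1..p - 1. 1 / of_nat k ^ 1 + 1 / of_nat (p - k) ^ 1 + ?p * (1 / of_nat k ^ 2)
      + ?p ^ 2 * (1 / of_nat k ^ 3) + ?p ^ 3 * (1 / of_nat k ^ 4)) \<in> \<P> 4"
    using summand by (intro ideal_sum)
  then have "2 * power_harmonic (p - 1) 1 + ?p * power_harmonic (p - 1) 2
      + ?p ^ 2 * power_harmonic (p - 1) 3 + ?p ^ 3 * power_harmonic (p - 1) 4 \<in> \<P> 4"
    unfolding sum.distrib sum_reflect[of "\<lambda>k. 1 / of_nat k ^ 1"] sum_distrib_left[symmetric]
      power_harmonic_def[symmetric]
    by (simp only: mult_2)
  \<comment> \<open>Here p > 5 enters: H_3 must be divisible by p^2, and H_4 by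
    \<open>p\<close>.\<close>
  moreover have "?p ^ 2 * power_harmonic (p - 1) 3 \<in> \<P> 4"
    using assms by (intro ideal_mult_eq[of _ 2 _ 2] power_harmonic_odd_ideal_2) auto
  moreover have "?p ^ 3 * power_harmonic (p - 1) 4 \<in> \<P> 4"
    using assms by (intro ideal_mult_eq[of _ 3 _ 1] power_harmonic_ideal_1) auto
  ultimately show ?thesis
    using ideal_diff[OF ideal_diff] by fastforce
qed

lemma complete_harmonic_cong_3:
  assumes "odd r" "r + 1 < p - 1"
  shows "of_nat r * complete_harmonic (p - 1) r - power_harmonic (p - 1) r \<in> \<P> 3"
proof -
  have odd_2: "complete_harmonic (p - 1) t \<in> \<P> 2" if "odd t" "t \<le> r" for t
  proof (rule ideal_cancel_of_nat)
    have "of_nat t * complete_harmonic (p - 1) t - power_harmonic (p - 1) t + power_harmonic (p - 1) t \<in> \<P> 2"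
      using that assms
      by (intro ideal_add complete_harmonic_cong_2 power_harmonic_odd_ideal_2) (auto simp: odd_pos)
    then show "of_nat t * complete_harmonic (p - 1) t \<in> \<P> 2" by simp
    show "\<not> p dvd t"
      using that assms by (intro not_dvd_of_less) (auto simp: odd_pos)
  qed
  obtain q where q: "r = Suc q" using assms(1) by (cases r) auto
  \<comment> \<open>The two indices add up to the odd number \<open>r\<close>, so one is odd and its
    factor is divisible by p^2, the other by \<open>p\<close>.\<close>
  have "power_harmonic (p - 1) (Suc i) * complete_harmonic (p - 1) (q - i) \<in> \<P> 3" if "i < q" for i
  proof (cases "even i")
    case True
    then show ?thesis using that assms q
      by (intro ideal_mult_eq[of _ 2 _ 1] power_harmonic_odd_ideal_2 complete_harmonic_ideal_1) auto
  next
    case False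
    then show ?thesis using that assms q
      by (intro ideal_mult_eq[of _ 1 _ 2] power_harmonic_ideal_1 odd_2) auto
  qed
  then show ?thesis
    unfolding q complete_harmonic_newton_remainder by (intro ideal_sum) auto
qed

section \<open>Double harmonic sums and Bernoulli numbers\<close>

lemma binomial_p_minus_1_cong:
  assumes "k < p"
  shows "of_nat ((p - 1) choose k) - (- 1) ^ k \<in> \<P> 1"
proof -
  have "of_nat ((p - 1) choose k) - (- 1) ^ k = (- 1) ^ k * (signed_power 1 k - 1)"
    unfolding signed_power_1 by (simp add: right_diff_distrib mult.assoc[symmetric] flip: power_add mult_2)
  also have "\<dots> \<in> \<P> 1"
    using signed_power_1_cong_1[OF assms] ideal_power_0[of "- 1" k] ideal_uminus[OF one_ideal_0]
    by (intro ideal_mult_left) auto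
  finally show ?thesis .
qed

text \<open>Case a = 1, b = 2n: both factors reduce modulo \<open>p\<close>, p - 1 to -1 and the
  binomial coefficient to 1, and the diagonal H_(2n+1) vanishes.\<close>

lemma double_power_harmonic_1_even:
  assumes "1 \<le> n" "2 * n + 1 \<le> p - 2"
  shows "(\<Sum>k = 1..p - 1. power_harmonic k 1 / of_nat k ^ (2 * n)) - bernoulli_num (p - 1 - 2 * n) \<in> \<P> 1"
proof -
  define D where "D = (\<Sum>k = 1..p - 1. power_harmonic (k - 1) 1 / of_nat k ^ (2 * n))"
  define B where "B = bernoulli_num (p - 1 - 2 * n)"
  define C :: rat where "C = of_nat ((p - 1) choose (2 * n))"
  have B: "B \<in> \<P> 0"
    unfolding B_def using assms by (intro bernoulli_num_ideal) auto
  have D0: "D \<in> \<P> 0"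
    unfolding D_def by (intro ideal_sum divide_power_ideal power_harmonic_ideal_0) auto
  have C: "C - 1 \<in> \<P> 1"
    using binomial_p_minus_1_cong[of "2 * n"] assms by (simp add: C_def)
  have main: "of_nat (p - 1) * D + C * B \<in> \<P> 1"
    unfolding D_def B_def C_def using assms by (intro double_power_harmonic_cong) auto
  have P: "power_harmonic (p - 1) (1 + 2 * n) \<in> \<P> 1"
    using assms by (intro power_harmonic_ideal_1) auto
  have eq: "of_nat (p - 1) = (of_nat p - 1 :: rat)"
    by (simp add: of_nat_diff Suc_leI)
  have "D + power_harmonic (p - 1) (1 + 2 * n) - B
      = of_nat p * D + (C - 1) * B - (of_nat (p - 1) * D + C * B) + power_harmonic (p - 1) (1 + 2 * n)"
    unfolding eq by (simp add: algebra_simps)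
  also have "\<dots> \<in> \<P> 1"
    by (intro ideal_add[OF _ P] ideal_diff[OF _ main] ideal_add[OF ideal_mult_right[OF ideal_p D0]]
        ideal_mult_right[OF C B])
  finally show ?thesis
    unfolding double_power_harmonic_split D_def B_def .
qed

text \<open>Case a = 2, b = 2n - 1: modulo \<open>p\<close> the factor p - 2 is -2 and the binomial
  coefficient is -2n, so halving gives -n B.\<close>

lemma double_power_harmonic_2_odd:
  assumes "1 \<le> n" "2 * n + 1 \<le> p - 2"
  shows "(\<Sum>k = 1..p - 1. power_harmonic k 2 / of_nat k ^ (2 * n - 1))
     + of_nat n * bernoulli_num (p - 1 - 2 * n) \<in> \<P> 1"
proof -
  define D where "D = (\<Sum>k = 1..p - 1. power_harmonic (k - 1) 2 / of_nat k ^ (2 * n - 1))"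
  define B where "B = bernoulli_num (p - 1 - 2 * n)"
  define C :: rat where "C = of_nat ((p - 1) choose (2 * n - 1))"
  define C' :: rat where "C' = of_nat ((p - 2) choose (2 * n - 1))"
  have B: "B \<in> \<P> 0"
    unfolding B_def using assms by (intro bernoulli_num_ideal) auto
  have D0: "D \<in> \<P> 0"
    unfolding D_def by (intro ideal_sum divide_power_ideal power_harmonic_ideal_0) auto
  have C0: "C \<in> \<P> 0" "C' \<in> \<P> 0"
    by (auto simp: C_def C'_def)
  have C: "C + 1 \<in> \<P> 1"
    using binomial_p_minus_1_cong[of "2 * n - 1"] assms by (simp add: C_def)
  \<comment> \<open>Absorption reduces the row p - 2 to the row p - 1, whose entries are known to be
    signs modulo \<open>p\<close>.\<close>
  have "(p - 1 - (2 * n - 1)) * ((p - 1) choose (2 * n - 1)) = (p - 1) * ((p - 2) choose (2 * n - 1))"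
    using binomial_absorb_comp[of "p - 1" "2 * n - 1"] by (simp add: numeral_2_eq_2)
  then have "of_nat ((p - 1 - (2 * n - 1)) * ((p - 1) choose (2 * n - 1)))
      = (of_nat ((p - 1) * ((p - 2) choose (2 * n - 1))) :: rat)"
    by (simp only:)
  then have "(of_nat p - 2 * of_nat n) * C = (of_nat p - 1) * C'"
    using assms by (simp add: C_def C'_def of_nat_diff)
  then have "C' + 2 * of_nat n = of_nat p * (C' - C) + 2 * of_nat n * (C + 1)"
    by (simp add: algebra_simps)
  also have "\<dots> \<in> \<P> 1"
    using C0 by (intro ideal_add ideal_mult_right[OF ideal_p] ideal_mult_left[OF _ C] ideal_diff ideal_mult_left) auto
  finally have C': "C' + 2 * of_nat n \<in> \<P> 1" .
  have "of_nat (p - 2) * D + C' * bernoulli_num (p - 2 - (2 * n - 1)) \<in> \<P> 1"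
    unfolding D_def C'_def using assms by (intro double_power_harmonic_cong) auto
  moreover have "p - 2 - (2 * n - 1) = p - 1 - 2 * n"
    using assms by auto
  ultimately have main: "of_nat (p - 2) * D + C' * B \<in> \<P> 1"
    by (simp only: B_def)
  have P: "power_harmonic (p - 1) (2 + (2 * n - 1)) \<in> \<P> 1"
    using assms by (intro power_harmonic_ideal_1) auto
  have "of_nat (p - 2) = (of_nat p - 2 :: rat)"
    using assms by (simp add: of_nat_diff)
  then have "of_nat 2 * (D + of_nat n * B)
      = of_nat p * D + (C' + 2 * of_nat n) * B - (of_nat (p - 2) * D + C' * B)"
    by (simp add: algebra_simps)
  also have "\<dots> \<in> \<P> 1"
    by (intro ideal_diff[OF _ main] ideal_add[OF ideal_mult_right[OF ideal_p D0]]
        ideal_mult_right[OF C' B])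
  finally have "D + of_nat n * B \<in> \<P> 1"
    by (rule ideal_cancel_of_nat) (use assms in \<open>intro not_dvd_of_less, auto\<close>)
  from ideal_add[OF this P]
  show ?thesis
    unfolding double_power_harmonic_split D_def B_def by (simp only: add_ac)
qed

text \<open>Modulo p^2, Newton gives 2n h = H and the expansion of the sum for m = 1 gives -h = H -
  p T. Eliminating H leaves (2n + 1) h = p T, and T is B modulo \<open>p\<close>.\<close>

lemma complete_harmonic_even_bernoulli_cong:
  assumes "1 \<le> n" "2 * n + 1 \<le> p - 2"
  shows "complete_harmonic (p - 1) (2 * n)
     - of_nat p / of_nat (2 * n + 1) * bernoulli_num (p - 1 - 2 * n) \<in> \<P> 2"
proof -
  define h where "h = complete_harmonic (p - 1) (2 * n)"
  define H where "H = power_harmonic (p - 1) (2 * n)"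
  define B where "B = bernoulli_num (p - 1 - 2 * n)"
  define T where "T = (\<Sum>k = 1..p - 1. power_harmonic k 1 / of_nat k ^ (2 * n))"
  have newton: "of_nat (2 * n) * h - H \<in> \<P> 2"
    unfolding h_def H_def using assms by (intro complete_harmonic_cong_2) auto
  have T: "T - B \<in> \<P> 1"
    unfolding T_def B_def using assms by (intro double_power_harmonic_1_even)
  have "(\<Sum>k = 1..p - 1. (signed_power 1 k - (1 - of_nat p * power_harmonic k 1)) / of_nat k ^ (2 * n)) \<in> \<P> 2"
    by (intro ideal_sum divide_power_ideal signed_power_1_cong) auto
  also have "(\<Sum>k = 1..p - 1. (signed_power 1 k - (1 - of_nat p * power_harmonic k 1)) / of_nat k ^ (2 * n))
      = (\<Sum>k = 1..p - 1. signed_power 1 k / of_nat k ^ (2 * n)) - (H - of_nat p * T)"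
    unfolding T_def H_def power_harmonic_def[of "p - 1"] sum_distrib_left sum_subtractf[symmetric]
    by (intro sum.cong refl) (simp only: diff_divide_distrib times_divide_eq_right)
  also have "(\<Sum>k = 1..p - 1. signed_power 1 k / of_nat k ^ (2 * n)) = - h"
    unfolding h_def using assms by (intro signed_power_1_sum) auto
  finally have sum: "- h - (H - of_nat p * T) \<in> \<P> 2" .
  have cancel: "N * (h - of_nat p / N * B) = N * h - of_nat p * B" if "N \<noteq> 0" for N
    using that by (simp add: field_simps)
  have "of_nat (2 * n + 1) * (h - of_nat p / of_nat (2 * n + 1) * B)
      = of_nat (2 * n + 1) * h - of_nat p * B"
    by (rule cancel) (simp only: of_nat_eq_0_iff)
  also have "\<dots> = (of_nat (2 * n) * h - H) - (- h - (H - of_nat p * T)) + of_nat p * (T - B)"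
    by (simp add: algebra_simps)
  also have "\<dots> \<in> \<P> 2"
    using T by (intro ideal_add[OF ideal_diff[OF newton sum]] ideal_mult_eq[OF ideal_p T]) auto
  finally have "h - of_nat p / of_nat (2 * n + 1) * B \<in> \<P> 2"
    by (rule ideal_cancel_of_nat) (use assms in \<open>intro not_dvd_of_less, auto\<close>)
  then show ?thesis
    unfolding h_def B_def .
qed

text \<open>Chain r h_r = H_r and 2 H_r = -r p H_(2n) modulo p^3 with H_(2n) = 2n h_(2n) modulo p^2;
  the factor \<open>p\<close> lifts the last to p^3, and the even case evaluates h_(2n).\<close>

lemma complete_harmonic_odd_bernoulli_cong:
  assumes "1 \<le> n" "2 * n + 1 \<le> p - 2"
  shows "complete_harmonic (p - 1) (2 * n - 1)
     + of_nat p ^ 2 * (of_nat n / of_nat (2 * n + 1) * bernoulli_num (p - 1 - 2 * n)) \<in> \<P> 3"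
proof -
  define r where "r = 2 * n - 1"
  define h where "h = complete_harmonic (p - 1) r"
  define h' where "h' = complete_harmonic (p - 1) (2 * n)"
  define H where "H = power_harmonic (p - 1) r"
  define H' where "H' = power_harmonic (p - 1) (2 * n)"
  define X where "X = bernoulli_num (p - 1 - 2 * n) / of_nat (2 * n + 1)"
  have r: "odd r" "r + 1 = 2 * n" "0 < r" "r + 2 < p - 1" using assms by (auto simp: r_def)
  have newton: "of_nat r * h - H \<in> \<P> 3"
    unfolding h_def H_def using r by (intro complete_harmonic_cong_3) auto
  have newton': "of_nat (2 * n) * h' - H' \<in> \<P> 2"
    unfolding h'_def H'_def using assms by (intro complete_harmonic_cong_2) auto
  have H: "2 * H + of_nat r * of_nat p * H' \<in> \<P> 3"
    unfolding H_def H'_def r(2)[symmetric] using r by (intro power_harmonic_odd_cong)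
  have h': "h' - of_nat p * X \<in> \<P> 2"
    using complete_harmonic_even_bernoulli_cong[OF assms] by (simp add: h'_def X_def)
  have not_dvd: "\<not> p dvd 2 * r"
  proof
    assume "p dvd 2 * r"
    moreover have "\<not> p dvd 2" "\<not> p dvd r" using r by (intro not_dvd_of_less; auto)+
    ultimately show False using prime_p prime_dvd_mult_iff by blast
  qed
  have rest: "of_nat p * ((of_nat (2 * n) * h' - H') - of_nat (2 * n) * (h' - of_nat p * X)) \<in> \<P> 3"
    by (intro ideal_mult_eq[OF ideal_p ideal_diff[OF newton' ideal_mult_left[OF of_nat_ideal_0 h']]]) simp
  have "of_nat (2 * r) * (h + of_nat p ^ 2 * (of_nat n * X))
      = 2 * (of_nat r * h - H) + (2 * H + of_nat r * of_nat p * H')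
        + of_nat r * (of_nat p * ((of_nat (2 * n) * h' - H') - of_nat (2 * n) * (h' - of_nat p * X)))"
    by (simp add: algebra_simps power2_eq_square)
  also have "\<dots> \<in> \<P> 3"
    by (rule ideal_add[OF ideal_add[OF ideal_mult_left[OF numeral_ideal_0 newton] H]
          ideal_mult_left[OF of_nat_ideal_0 rest]])
  finally have "h + of_nat p ^ 2 * (of_nat n * X) \<in> \<P> 3"
    using not_dvd by (rule ideal_cancel_of_nat)
  then show ?thesis
    by (simp only: h_def r_def X_def times_divide_eq_left times_divide_eq_right)
qed

section \<open>The three congruences for general m\<close>

lemma signed_power_sum_2:
  assumes "p > 5" "\<not> p dvd m"
  shows "rat_cong (\<Sum>k = 1..p - 1. signed_power m k / of_nat k ^ 2)
     (power_harmonic (p - 1) 1 / of_nat p) p 3"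
proof (rule rat_congI)
  define S where "S = (\<Sum>k = 1..p - 1. signed_power m k / of_nat k ^ 2)"
  define c :: rat where "c = (of_nat m - 1) / (2 * of_nat m)"
  define T where "T = (\<Sum>k = 1..p - 1. power_harmonic k 2 / of_nat k ^ 2)"
  define h where "h = complete_harmonic (p - 1) 2"
  define H1 where "H1 = power_harmonic (p - 1) 1"
  define H2 where "H2 = power_harmonic (p - 1) 2"
  have p2: "\<not> p dvd 2" using assms by (intro not_dvd_of_less) auto
  have H1: "H1 \<in> \<P> 2"
    unfolding H1_def using assms by (intro power_harmonic_odd_ideal_2) auto
  then show "power_harmonic (p - 1) 1 / of_nat p \<in> \<P> 0"
    using divide_p_power_ideal[of H1 0 1] ideal_mono[of H1 2 1] by (simp add: H1_def)
  have c: "2 * of_nat m * c = of_nat m - 1"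
    using assms(2) by (cases m) (auto simp: c_def)
  have S: "S + h - of_nat p ^ 2 * (c * T) \<in> \<P> 3"
    unfolding S_def h_def c_def T_def using assms by (intro signed_power_sum_cong) auto
  \<comment> \<open>Newton's identity in degree 2. As H_1^2 is divisible by p^4, the main term is
    -H_2/2, which \<open>power_harmonic_1_cong_4\<close> divided by \<open>p\<close> turns into
    H_1/p.\<close>
  have h: "2 * h = H1 * H1 + H2"
    using complete_harmonic_newton[of 1 "p - 1"] complete_harmonic_newton[of 0 "p - 1"]
    by (simp add: h_def H1_def H2_def numeral_2_eq_2)
  have H2: "H2 \<in> \<P> 1"
    unfolding H2_def using assms by (intro power_harmonic_ideal_1) auto
  \<comment> \<open>The double sum is divisible by \<open>p\<close>, so the dependence on
    \<open>m\<close> disappears modulo p^3.\<close>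
  have "2 * T = H2 * H2 + power_harmonic (p - 1) 4"
    unfolding T_def H2_def double_power_harmonic_diagonal by (simp add: power2_eq_square)
  also have "\<dots> \<in> \<P> 1"
    using assms
    by (intro ideal_add[OF ideal_mult_right[OF H2 ideal_mono[OF H2]]] power_harmonic_ideal_1) auto
  finally have "of_nat 2 * T \<in> \<P> 1" by simp
  from ideal_cancel_of_nat[OF this p2] have T1: "T \<in> \<P> 1" .
  have m1: "of_nat m - 1 \<in> \<P> 0"
    by (intro ideal_diff) auto
  have T: "of_nat p ^ 2 * ((of_nat m - 1) * T) \<in> \<P> 3"
    by (intro ideal_mult_eq[OF ideal_p_power ideal_mult_left[OF m1 T1]]) simp
  have H1_square: "H1 * H1 \<in> \<P> 3"
    using ideal_mono[OF ideal_mult[OF H1 H1], of 3] by simp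
  have H: "2 * H1 + of_nat p * H2 \<in> \<P> 4"
    unfolding H1_def H2_def using assms by (intro power_harmonic_1_cong_4)
  have "(2 * H1 + of_nat p * H2) / of_nat p = 2 * (H1 / of_nat p) + H2"
    by (simp add: add_divide_distrib)
  then have H': "2 * (H1 / of_nat p) + H2 \<in> \<P> 3"
    using divide_p_power_ideal[of "2 * H1 + of_nat p * H2" 3 1] H by simp
  have "of_nat (2 * m) * (S - H1 / of_nat p)
      = of_nat m * (2 * (S + h - of_nat p ^ 2 * (c * T)) - H1 * H1 - (2 * (H1 / of_nat p) + H2))
        + of_nat p ^ 2 * ((of_nat m - 1) * T)"
    unfolding c[symmetric] using h by (simp add: algebra_simps)
  also have "\<dots> \<in> \<P> 3"
    by (rule ideal_add[OF ideal_mult_left[OF of_nat_ideal_0 ideal_diff[OF ideal_diff[OF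
          ideal_mult_left[OF numeral_ideal_0 S] H1_square] H']] T])
  finally have "of_nat (2 * m) * (S - H1 / of_nat p) \<in> \<P> 3" .
  moreover have "\<not> p dvd 2 * m"
    using assms(2) p2 prime_p prime_dvd_mult_iff by blast
  ultimately have "S - H1 / of_nat p \<in> \<P> 3"
    by (rule ideal_cancel_of_nat)
  then show "(\<Sum>k = 1..p - 1. signed_power m k / of_nat k ^ 2)
      - power_harmonic (p - 1) 1 / of_nat p \<in> \<P> 3"
    by (simp only: S_def H1_def)
qed

lemma signed_power_sum_even:
  assumes "1 \<le> n" "2 * n + 1 \<le> p - 2" "\<not> p dvd m"
  shows "rat_cong (\<Sum>k = 1..p - 1. signed_power m k / of_nat k ^ (2 * n))
     (- (of_nat p / of_nat (2 * n + 1)) * bernoulli_num (p - 1 - 2 * n)) p 2"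
proof (rule rat_congI)
  define S where "S = (\<Sum>k = 1..p - 1. signed_power m k / of_nat k ^ (2 * n))"
  define c :: rat where "c = (of_nat m - 1) / of_nat (2 * m)"
  define T where "T = (\<Sum>k = 1..p - 1. power_harmonic k 2 / of_nat k ^ (2 * n))"
  define h where "h = complete_harmonic (p - 1) (2 * n)"
  define B where "B = bernoulli_num (p - 1 - 2 * n)"
  have n: "\<not> p dvd 2 * n + 1" and p2: "\<not> p dvd 2"
    using assms by (intro not_dvd_of_less; auto)+
  have "\<not> p dvd 2 * m"
    using assms(3) p2 prime_p prime_dvd_mult_iff by blast
  then have c: "c \<in> \<P> 0"
    unfolding c_def by (intro divide_of_nat_ideal ideal_diff) auto
  have B: "B \<in> \<P> 0"
    unfolding B_def using assms by (intro bernoulli_num_ideal) auto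
  show "- (of_nat p / of_nat (2 * n + 1)) * bernoulli_num (p - 1 - 2 * n) \<in> \<P> 0"
    unfolding B_def[symmetric]
    by (intro ideal_mult_left[OF ideal_uminus B] divide_of_nat_ideal n of_nat_ideal_0)
  have T: "T \<in> \<P> 0"
    unfolding T_def by (intro ideal_sum divide_power_ideal power_harmonic_ideal_0) auto
  have "S + h - of_nat p ^ 2 * ((of_nat m - 1) / (2 * of_nat m) * T) \<in> \<P> 3"
    unfolding S_def h_def T_def using assms p2 by (intro signed_power_sum_cong) auto
  \<comment> \<open>Modulo p^2 the correction in \<open>m\<close> is already zero.\<close>
  then have S: "S + h - of_nat p ^ 2 * (c * T) \<in> \<P> 2"
    using ideal_mono[of _ 3 2] by (simp add: c_def)
  have h: "h - of_nat p / of_nat (2 * n + 1) * B \<in> \<P> 2"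
    unfolding h_def B_def using assms by (intro complete_harmonic_even_bernoulli_cong)
  have "S - - (of_nat p / of_nat (2 * n + 1)) * B
      = (S + h - of_nat p ^ 2 * (c * T)) - (h - of_nat p / of_nat (2 * n + 1) * B) + of_nat p ^ 2 * (c * T)"
    by simp
  also have "\<dots> \<in> \<P> 2"
    using c T by (intro ideal_add[OF ideal_diff[OF S h]] ideal_mult_right ideal_p_power) auto
  finally show "(\<Sum>k = 1..p - 1. signed_power m k / of_nat k ^ (2 * n))
      - - (of_nat p / of_nat (2 * n + 1)) * bernoulli_num (p - 1 - 2 * n) \<in> \<P> 2"
    by (simp only: S_def B_def)
qed

lemma signed_power_sum_odd:
  assumes "1 \<le> n" "2 * n + 1 \<le> p - 2" "\<not> p dvd m"
  shows "rat_cong (\<Sum>k = 1..p - 1. signed_power m k / of_nat k ^ (2 * n - 1))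
     ((1 + (1 - of_nat m) / (2 * of_nat m) * of_nat (2 * n + 1))
       * (of_nat p ^ 2 * of_nat n / of_nat (2 * n + 1)) * bernoulli_num (p - 1 - 2 * n)) p 3"
proof (rule rat_congI)
  define S where "S = (\<Sum>k = 1..p - 1. signed_power m k / of_nat k ^ (2 * n - 1))"
  define c :: rat where "c = (of_nat m - 1) / of_nat (2 * m)"
  define T where "T = (\<Sum>k = 1..p - 1. power_harmonic k 2 / of_nat k ^ (2 * n - 1))"
  define h where "h = complete_harmonic (p - 1) (2 * n - 1)"
  define B where "B = bernoulli_num (p - 1 - 2 * n)"
  define X where "X = of_nat n / of_nat (2 * n + 1) * B"
  define R where "R = (1 + (1 - of_nat m) / (2 * of_nat m) * of_nat (2 * n + 1))
       * (of_nat p ^ 2 * of_nat n / of_nat (2 * n + 1)) * B"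
  have n: "\<not> p dvd 2 * n + 1" and p2: "\<not> p dvd 2"
    using assms by (intro not_dvd_of_less; auto)+
  have "\<not> p dvd 2 * m"
    using assms(3) p2 prime_p prime_dvd_mult_iff by blast
  then have c: "c \<in> \<P> 0"
    unfolding c_def by (intro divide_of_nat_ideal ideal_diff) auto
  have B: "B \<in> \<P> 0"
    unfolding B_def using assms by (intro bernoulli_num_ideal) auto
  have X: "X \<in> \<P> 0"
    unfolding X_def by (intro ideal_mult_left[OF _ B] divide_of_nat_ideal n of_nat_ideal_0)
  have cancel: "(1 - c * N) * (a / N * B) = a / N * B - c * (a * B)" if "N \<noteq> 0" for N a
    using that by (simp add: field_simps)
  have minus_c: "(1 - of_nat m) / (2 * of_nat m) = - c"
    by (simp add: c_def minus_divide_left)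
  have "R = of_nat p ^ 2 * ((1 - c * of_nat (2 * n + 1)) * X)"
    unfolding R_def X_def minus_c by (simp add: mult_ac)
  also have "(1 - c * of_nat (2 * n + 1)) * X = X - c * (of_nat n * B)"
    unfolding X_def by (rule cancel) (simp only: of_nat_eq_0_iff)
  \<comment> \<open>The two terms match the two sources: \<open>X\<close> comes from -h and the
    multiple of \<open>c\<close> from the double sum, which is -n B modulo \<open>p\<close>.\<close>
  finally have R: "R = of_nat p ^ 2 * (X - c * (of_nat n * B))" .
  have "R \<in> \<P> 2"
    unfolding R using X c B
    by (intro ideal_mult_right[OF ideal_p_power] ideal_diff ideal_mult_left) auto
  then show "(1 + (1 - of_nat m) / (2 * of_nat m) * of_nat (2 * n + 1))
       * (of_nat p ^ 2 * of_nat n / of_nat (2 * n + 1)) * bernoulli_num (p - 1 - 2 * n) \<in> \<P> 0"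
    unfolding R_def B_def by (rule ideal_mono) simp
  have T: "T + of_nat n * B \<in> \<P> 1"
    unfolding T_def B_def using assms by (intro double_power_harmonic_2_odd)
  have "S + h - of_nat p ^ 2 * ((of_nat m - 1) / (2 * of_nat m) * T) \<in> \<P> 3"
    unfolding S_def h_def T_def using assms p2 by (intro signed_power_sum_cong) auto
  then have S: "S + h - of_nat p ^ 2 * (c * T) \<in> \<P> 3"
    by (simp add: c_def)
  have h: "h + of_nat p ^ 2 * X \<in> \<P> 3"
    unfolding h_def X_def B_def using assms by (intro complete_harmonic_odd_bernoulli_cong)
  have "S - R = (S + h - of_nat p ^ 2 * (c * T)) - (h + of_nat p ^ 2 * X)
      + of_nat p ^ 2 * (c * (T + of_nat n * B))"
    unfolding R by (simp add: algebra_simps)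
  also have "\<dots> \<in> \<P> 3"
    by (intro ideal_add[OF ideal_diff[OF S h]] ideal_mult_eq[OF ideal_p_power ideal_mult_left[OF c T]]) simp
  finally show "(\<Sum>k = 1..p - 1. signed_power m k / of_nat k ^ (2 * n - 1))
      - (1 + (1 - of_nat m) / (2 * of_nat m) * of_nat (2 * n + 1))
       * (of_nat p ^ 2 * of_nat n / of_nat (2 * n + 1)) * bernoulli_num (p - 1 - 2 * n) \<in> \<P> 3"
    by (simp only: S_def R_def B_def)
qed

end

theorem theorem1p3:
  fixes p m :: nat
  assumes "prime p" and "p > 3" and "m > 0" and "\<not> p dvd m"
  shows
    "(p > 5 \<longrightarrow>
        rat_cong
          (\<Sum>k = 1..p - 1. (- 1) ^ (k * m) / of_nat k ^ 2
             * ((of_nat p / of_nat m - 1) gchoose k) ^ m)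
          (1 / of_nat p * (\<Sum>k = 1..p - 1. 1 / of_nat k))
          p 3) \<and>
     (\<forall>n \<in> {1..(p - 3) div 2}.
        rat_cong
          (\<Sum>k = 1..p - 1. (- 1) ^ (k * m) / of_nat k ^ (2 * n)
             * ((of_nat p / of_nat m - 1) gchoose k) ^ m)
          (- (of_nat p / of_nat (2 * n + 1)) * bernoulli_num (p - 1 - 2 * n))
          p 2) \<and>
     (\<forall>n \<in> {1..(p - 3) div 2}.
        rat_cong
          (\<Sum>k = 1..p - 1. (- 1) ^ (k * m) / of_nat k ^ (2 * n - 1)
             * ((of_nat p / of_nat m - 1) gchoose k) ^ m)
          ((1 + (1 - of_nat m) / (2 * of_nat m) * of_nat (2 * n + 1))
             * (of_nat p ^ 2 * of_nat n / of_nat (2 * n + 1)) * bernoulli_num (p - 1 - 2 * n))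
          p 3)"
proof -
  interpret prime_localization p
    by unfold_locales (rule assms(1))
  have summand: "(- 1) ^ (k * m) / of_nat k ^ r * ((of_nat p / of_nat m - 1) gchoose k) ^ m
      = signed_power m k / of_nat k ^ r" for k r
    by (simp only: signed_power_def times_divide_eq_left)
  have harmonic: "1 / of_nat p * (\<Sum>k = 1..p - 1. 1 / of_nat k) = power_harmonic (p - 1) 1 / of_nat p"
    by (simp add: power_harmonic_def)
  show ?thesis
    unfolding summand harmonic
    \<comment> \<open>The range of \<open>n\<close> gives 2n + 1 <= p - 2, the bound used by the
      lemmas.\<close>
    by (intro conjI impI ballI signed_power_sum_2 signed_power_sum_even signed_power_sum_odd)
      (use assms in auto)
qed

end
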